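(* Suppose a Hermitian manifold $(M,J,g)$ is an LCK (locally conformally Kähler) manifold with potential. Then $Q$ has the additional symmetry $Q_{i\bar jk\bar l}=Q_{k\bar li\bar j}$.
   Context: A compact Hermitian manifold $(M,J,g)$ with associated form $\omega$ is locally conformally Kähler (LCK) if there is a closed $1$-form $\theta$ (the Lee form) with $d\omega=\theta\wedge\omega$. An LCK manifold has a potential (is LCK with potential) if it has a Kähler covering $\pi:\tilde M\to M$ with a global positive Kähler potential $\varphi\in C^\infty_{>0}(\tilde M)$ (so $i\partial\bar\partial\varphi$ is a Kähler form on $\tilde M$) such that $\varphi^{-1}i\partial\bar\partial\varphi=c\,\pi^*\omega$ for some constant $c$. Notation: in local holomorphic coordinates, with $g_{i\bar j}$ the metric and $g^{i\bar j}$ its inverse, $\Gamma_{ki}^j=g^{j\bar m}\partial_kg_{i\bar m}$ (Chern connection); $T_{ij}^k=\Gamma_{ij}^k-\Gamma_{ji}^k$, $T_{ij\bar k}=g_{m\bar k}T_{ij}^m$ (Chern torsion); $R_{i\bar jk}{}^{l}=-\partial_{\bar j}\Gamma_{ik}^l$, $R_{i\bar jk\bar l}=g_{m\bar l}R_{i\bar jk}{}^{m}$ (Chern curvature). Define $Q_{i\bar jk\bar l}=R_{i\bar jk\bar l}-g^{p\bar q}T_{kp\bar j}\overline{T_{lq\bar i}}$. *)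

theory Defs
  imports "HOL-Analysis.Analysis"
begin

section \<open>Smooth and holomorphic maps\<close>

fun C_k_on :: "nat \<Rightarrow> ('a::real_normed_vector \<Rightarrow> 'b::real_normed_vector) \<Rightarrow> 'a set \<Rightarrow> bool" where
  "C_k_on 0 f S \<longleftrightarrow> continuous_on S f"
| "C_k_on (Suc k) f S \<longleftrightarrow>
     (\<forall>x\<in>S. f differentiable (at x)) \<and> (\<forall>v. C_k_on k (\<lambda>x. frechet_derivative f (at x) v) S)"

text \<open>Only used for open \<open>S\<close> in finite-dimensional spaces, where directional derivatives in all
  fixed directions detect the class \<open>C\<^sup>k\<close>.\<close>

definition smooth_on :: "('a::real_normed_vector \<Rightarrow> 'b::real_normed_vector) \<Rightarrow> 'a set \<Rightarrow> bool" where
  "smooth_on f S \<longleftrightarrow> (\<forall>k. C_k_on k f S)"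

definition hol_map_on :: "(complex^'a::finite \<Rightarrow> complex^'b::finite) \<Rightarrow> (complex^'a) set \<Rightarrow> bool" where
  "hol_map_on f S \<longleftrightarrow>
     (\<forall>z\<in>S. \<exists>D. (f has_derivative D) (at z) \<and> (\<forall>a v. D (a *s v) = a *s D v))"

abbreviation cx_J :: "complex^'n::finite \<Rightarrow> complex^'n" where
  "cx_J v \<equiv> \<i> *s v"

text \<open>The Wirtinger derivatives along \<open>z\<^sub>i = x\<^sub>i + \<i> y\<^sub>i\<close>; the vectors \<open>axis i 1\<close> and \<open>axis i \<i>\<close>
  are the coordinate directions of \<open>x\<^sub>i\<close> and \<open>y\<^sub>i\<close>.\<close>

definition dz :: "'n::finite \<Rightarrow> (complex^'n \<Rightarrow> complex) \<Rightarrow> complex^'n \<Rightarrow> complex" where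
  "dz i f z = (frechet_derivative f (at z) (axis i 1)
               - \<i> * frechet_derivative f (at z) (axis i \<i>)) / 2"

definition dzbar :: "'n::finite \<Rightarrow> (complex^'n \<Rightarrow> complex) \<Rightarrow> complex^'n \<Rightarrow> complex" where
  "dzbar i f z = (frechet_derivative f (at z) (axis i 1)
                  + \<i> * frechet_derivative f (at z) (axis i \<i>)) / 2"


section \<open>Complex manifolds\<close>

text \<open>A complex manifold of dimension \<open>CARD('n)\<close> is a Hausdorff second countable space (a type
  \<open>'m\<close>) with a holomorphic atlas. The atlas need not be maximal, so a maximal one is allowed. In
  every chart the complex structure \<open>J\<close> is \<^const>\<open>cx_J\<close>.\<close>

type_synonym ('m, 'n) chart = "'m set \<times> ('m \<Rightarrow> complex^'n)"

definition chart_img :: "('m, 'n::finite) chart \<Rightarrow> (complex^'n) set" where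
  "chart_img c = snd c ` fst c"

definition chart_inv :: "('m, 'n::finite) chart \<Rightarrow> complex^'n \<Rightarrow> 'm" where
  "chart_inv c = inv_into (fst c) (snd c)"

definition is_chart :: "('m::topological_space, 'n::finite) chart \<Rightarrow> bool" where
  "is_chart c \<longleftrightarrow> open (fst c) \<and> open (chart_img c) \<and>
     homeomorphism (fst c) (chart_img c) (snd c) (chart_inv c)"

text \<open>The expression of a map \<open>p\<close> in a chart \<open>c\<close> of the source and a chart \<open>d\<close> of the target, and
  the open set on which it is meaningful. For \<open>p = id\<close> this is the change of coordinates.\<close>

definition loc_map ::
  "('m \<Rightarrow> 'k) \<Rightarrow> ('m, 'n::finite) chart \<Rightarrow> ('k, 'n) chart \<Rightarrow> complex^'n \<Rightarrow> complex^'n" where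
  "loc_map p c d z = snd d (p (chart_inv c z))"

definition loc_dom ::
  "('m \<Rightarrow> 'k) \<Rightarrow> ('m, 'n::finite) chart \<Rightarrow> ('k, 'n) chart \<Rightarrow> (complex^'n) set" where
  "loc_dom p c d = {z \<in> chart_img c. p (chart_inv c z) \<in> fst d}"

definition complex_manifold ::
  "('m::{t2_space,second_countable_topology}, 'n::finite) chart set \<Rightarrow> bool" where
  "complex_manifold A \<longleftrightarrow> (\<forall>c\<in>A. is_chart c) \<and> (\<Union>c\<in>A. fst c) = UNIV \<and>
     (\<forall>c\<in>A. \<forall>d\<in>A. hol_map_on (loc_map id c d) (loc_dom id c d))"

text \<open>Smooth functions and covariant tensor fields. A tensor field is given by its expressions in
  all charts, as multilinear functions of real tangent vectors in \<open>complex^'n\<close> which are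
  pulled back to each other by the changes of coordinates.\<close>

type_synonym ('m, 'n) one_tensor = "('m, 'n) chart \<Rightarrow> complex^'n \<Rightarrow> complex^'n \<Rightarrow> real"
type_synonym ('m, 'n) two_tensor =
  "('m, 'n) chart \<Rightarrow> complex^'n \<Rightarrow> complex^'n \<Rightarrow> complex^'n \<Rightarrow> real"

definition smooth_fun :: "('m, 'n::finite) chart set \<Rightarrow> ('m \<Rightarrow> real) \<Rightarrow> bool" where
  "smooth_fun A f \<longleftrightarrow> (\<forall>c\<in>A. smooth_on (\<lambda>z. f (chart_inv c z)) (chart_img c))"

definition one_form :: "('m, 'n::finite) chart set \<Rightarrow> ('m, 'n) one_tensor \<Rightarrow> bool" where
  "one_form A \<theta> \<longleftrightarrow>
     (\<forall>c\<in>A. (\<forall>z\<in>chart_img c. linear (\<theta> c z)) \<and> (\<forall>v. smooth_on (\<lambda>z. \<theta> c z v) (chart_img c))) \<and>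
     (\<forall>c\<in>A. \<forall>d\<in>A. \<forall>z\<in>loc_dom id c d. \<forall>v.
        \<theta> c z v = \<theta> d (loc_map id c d z) (frechet_derivative (loc_map id c d) (at z) v))"

definition two_tensor_field :: "('m, 'n::finite) chart set \<Rightarrow> ('m, 'n) two_tensor \<Rightarrow> bool" where
  "two_tensor_field A b \<longleftrightarrow>
     (\<forall>c\<in>A. (\<forall>z\<in>chart_img c. bilinear (b c z)) \<and>
            (\<forall>u v. smooth_on (\<lambda>z. b c z u v) (chart_img c))) \<and>
     (\<forall>c\<in>A. \<forall>d\<in>A. \<forall>z\<in>loc_dom id c d. \<forall>u v.
        b c z u v = b d (loc_map id c d z)
          (frechet_derivative (loc_map id c d) (at z) u)
          (frechet_derivative (loc_map id c d) (at z) v))"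

text \<open>Exterior calculus in one chart; \<open>u, v, w\<close> are constant vector fields, so that the bracket
  terms in the invariant formula for \<open>d\<close> vanish.\<close>

definition d_one :: "(complex^'n::finite \<Rightarrow> complex^'n \<Rightarrow> real) \<Rightarrow>
    complex^'n \<Rightarrow> complex^'n \<Rightarrow> complex^'n \<Rightarrow> real" where
  "d_one \<theta> z u v = frechet_derivative (\<lambda>x. \<theta> x v) (at z) u - frechet_derivative (\<lambda>x. \<theta> x u) (at z) v"

definition d_two :: "(complex^'n::finite \<Rightarrow> complex^'n \<Rightarrow> complex^'n \<Rightarrow> real) \<Rightarrow>
    complex^'n \<Rightarrow> complex^'n \<Rightarrow> complex^'n \<Rightarrow> complex^'n \<Rightarrow> real" where
  "d_two \<omega> z u v w = frechet_derivative (\<lambda>x. \<omega> x v w) (at z) u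
     - frechet_derivative (\<lambda>x. \<omega> x u w) (at z) v + frechet_derivative (\<lambda>x. \<omega> x u v) (at z) w"

definition wedge_one_two :: "(complex^'n::finite \<Rightarrow> real) \<Rightarrow> (complex^'n \<Rightarrow> complex^'n \<Rightarrow> real) \<Rightarrow>
    complex^'n \<Rightarrow> complex^'n \<Rightarrow> complex^'n \<Rightarrow> real" where
  "wedge_one_two \<theta> \<omega> u v w = \<theta> u * \<omega> v w - \<theta> v * \<omega> u w + \<theta> w * \<omega> u v"


section \<open>Hermitian, locally conformally Kaehler metrics\<close>

definition hermitian_metric :: "('m, 'n::finite) chart set \<Rightarrow> ('m, 'n) two_tensor \<Rightarrow> bool" where
  "hermitian_metric A g \<longleftrightarrow> two_tensor_field A g \<and>
     (\<forall>c\<in>A. \<forall>z\<in>chart_img c.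
        (\<forall>u v. g c z u v = g c z v u) \<and>
        (\<forall>u. u \<noteq> 0 \<longrightarrow> g c z u u > 0) \<and>
        (\<forall>u v. g c z (cx_J u) (cx_J v) = g c z u v))"

definition assoc_form :: "('m, 'n::finite) two_tensor \<Rightarrow> ('m, 'n) two_tensor" where
  "assoc_form g c z u v = g c z (cx_J u) v"

definition kahler_form :: "('m, 'n::finite) chart set \<Rightarrow> ('m, 'n) two_tensor \<Rightarrow> bool" where
  "kahler_form A \<Omega> \<longleftrightarrow> two_tensor_field A \<Omega> \<and>
     (\<forall>c\<in>A. \<forall>z\<in>chart_img c.
        (\<forall>u v. \<Omega> c z u v = - \<Omega> c z v u) \<and>
        (\<forall>u v. \<Omega> c z (cx_J u) (cx_J v) = \<Omega> c z u v) \<and>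
        (\<forall>u. u \<noteq> 0 \<longrightarrow> \<Omega> c z u (cx_J u) > 0) \<and>
        (\<forall>u v w. d_two (\<Omega> c) z u v w = 0))"

text \<open>\<open>\<i> \<partial> \<partial>\<^sub>b\<^sub>a\<^sub>r \<phi> = \<i> \<Sum> \<phi>\<^sub>i\<^sub>j dz\<^sub>i \<and> d(cnj z\<^sub>j)\<close>; its values on real tangent vectors are real for
  real \<open>\<phi>\<close> of class \<open>C\<^sup>2\<close>.\<close>

definition i_ddbar :: "('m \<Rightarrow> real) \<Rightarrow> ('m, 'n::finite) two_tensor" where
  "i_ddbar \<phi> c z u v = Re (\<i> * (\<Sum>i\<in>UNIV. \<Sum>j\<in>UNIV.
     dz i (dzbar j (\<lambda>x. complex_of_real (\<phi> (chart_inv c x)))) z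
       * (u $ i * cnj (v $ j) - v $ i * cnj (u $ j))))"

definition lck_manifold :: "('m::{t2_space,second_countable_topology}, 'n::finite) chart set \<Rightarrow>
    ('m, 'n) two_tensor \<Rightarrow> bool" where
  "lck_manifold A g \<longleftrightarrow> compact (UNIV :: 'm set) \<and> complex_manifold A \<and> hermitian_metric A g \<and>
     (\<exists>\<theta>. one_form A \<theta> \<and>
       (\<forall>c\<in>A. \<forall>z\<in>chart_img c.
          (\<forall>u v. d_one (\<theta> c) z u v = 0) \<and>
          (\<forall>u v w. d_two (assoc_form g c) z u v w
                    = wedge_one_two (\<theta> c z) (assoc_form g c z) u v w)))"

definition holomorphic_covering :: "('t::{t2_space,second_countable_topology}, 'n::finite) chart set
    \<Rightarrow> ('m::{t2_space,second_countable_topology}, 'n) chart set \<Rightarrow> ('t \<Rightarrow> 'm) \<Rightarrow> bool" where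
  "holomorphic_covering B A p \<longleftrightarrow> covering_space UNIV p UNIV \<and>
     (\<forall>c\<in>B. \<forall>d\<in>A. hol_map_on (loc_map p c d) (loc_dom p c d))"

text \<open>The covering manifold lives on the type \<open>'t\<close>. Its Kaehler form is \<open>\<i> \<partial> \<partial>\<^sub>b\<^sub>a\<^sub>r \<phi>\<close>. The last clause is
  \<open>\<phi>\<^sup>-\<^sup>1 \<i> \<partial> \<partial>\<^sub>b\<^sub>a\<^sub>r \<phi> = C p\<^sup>* \<omega>\<close>.\<close>

definition lck_with_potential :: "'t::{t2_space,second_countable_topology} itself \<Rightarrow>
    ('m::{t2_space,second_countable_topology}, 'n::finite) chart set \<Rightarrow>
    ('m, 'n) two_tensor \<Rightarrow> bool" where
  "lck_with_potential T A g \<longleftrightarrow> lck_manifold A g \<and>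
     (\<exists>(B :: ('t, 'n) chart set) p \<phi> C.
        complex_manifold B \<and> holomorphic_covering B A p \<and>
        smooth_fun B \<phi> \<and> (\<forall>x. \<phi> x > 0) \<and> kahler_form B (i_ddbar \<phi>) \<and>
        (\<forall>c\<in>B. \<forall>d\<in>A. \<forall>z\<in>loc_dom p c d. \<forall>u v.
           inverse (\<phi> (chart_inv c z)) * i_ddbar \<phi> c z u v
             = C * assoc_form g d (loc_map p c d z)
                 (frechet_derivative (loc_map p c d) (at z) u)
                 (frechet_derivative (loc_map p c d) (at z) v)))"


section \<open>Chern connection, torsion, curvature and the tensor Q in a chart\<close>

text \<open>Local components \<open>g(\<partial>\<^sub>i, cnj \<partial>\<^sub>j)\<close> of the complex bilinear extension of a real bilinear form,
  where \<open>\<partial>\<^sub>i = (e\<^sub>i - \<i> J e\<^sub>i) / 2\<close> with \<open>e\<^sub>i = axis i 1\<close>. The row is the holomorphic index and the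
  column the antiholomorphic one.\<close>

definition metric_comp :: "(complex^'n::finite \<Rightarrow> complex^'n \<Rightarrow> complex^'n \<Rightarrow> real) \<Rightarrow>
    complex^'n \<Rightarrow> complex^'n^'n" where
  "metric_comp h z = (\<chi> i j. Complex
     (h z (axis i 1) (axis j 1) + h z (cx_J (axis i 1)) (cx_J (axis j 1)))
     (h z (axis i 1) (cx_J (axis j 1)) - h z (cx_J (axis i 1)) (axis j 1)) / 4)"

text \<open>\<open>metric_inv G z j m\<close> is the coefficient of the inverse metric with holomorphic index \<open>j\<close> and
  antiholomorphic index \<open>m\<close>, normalised by \<open>\<Sum>\<^sub>m g\<^sub>i\<^sub>m g\<^sup>j\<^sup>m = \<delta>\<^sub>i\<^sub>j\<close>; hence the transposition.\<close>

definition metric_inv ::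
  "(complex^'n::finite \<Rightarrow> complex^'n^'n) \<Rightarrow> complex^'n \<Rightarrow> 'n \<Rightarrow> 'n \<Rightarrow> complex" where
  "metric_inv G z j m = matrix_inv (G z) $ m $ j"

text \<open>In the names below, the argument order is that of the indices: \<open>chern_Gamma G k i j\<close> is
  \<open>\<Gamma>\<^sub>k\<^sub>i\<^sup>j\<close>, \<open>torsion_up G i j k\<close> is \<open>T\<^sub>i\<^sub>j\<^sup>k\<close>, and \<open>curv_up G i j k l\<close> is the curvature with upper
  index \<open>l\<close> and antiholomorphic index \<open>j\<close>; in \<open>curv\<close> and \<open>Q_tensor\<close> the indices \<open>j, l\<close> are
  antiholomorphic, in \<open>torsion\<close> the index \<open>k\<close>.\<close>

definition chern_Gamma ::
  "(complex^'n::finite \<Rightarrow> complex^'n^'n) \<Rightarrow> 'n \<Rightarrow> 'n \<Rightarrow> 'n \<Rightarrow> complex^'n \<Rightarrow> complex" where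
  "chern_Gamma G k i j z = (\<Sum>m\<in>UNIV. metric_inv G z j m * dz k (\<lambda>x. G x $ i $ m) z)"

definition torsion_up ::
  "(complex^'n::finite \<Rightarrow> complex^'n^'n) \<Rightarrow> 'n \<Rightarrow> 'n \<Rightarrow> 'n \<Rightarrow> complex^'n \<Rightarrow> complex" where
  "torsion_up G i j k z = chern_Gamma G i j k z - chern_Gamma G j i k z"

definition torsion ::
  "(complex^'n::finite \<Rightarrow> complex^'n^'n) \<Rightarrow> 'n \<Rightarrow> 'n \<Rightarrow> 'n \<Rightarrow> complex^'n \<Rightarrow> complex" where
  "torsion G i j k z = (\<Sum>m\<in>UNIV. G z $ m $ k * torsion_up G i j m z)"

definition curv_up ::
  "(complex^'n::finite \<Rightarrow> complex^'n^'n) \<Rightarrow> 'n \<Rightarrow> 'n \<Rightarrow> 'n \<Rightarrow> 'n \<Rightarrow> complex^'n \<Rightarrow> complex" where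
  "curv_up G i j k l z = - dzbar j (chern_Gamma G i k l) z"

definition curv ::
  "(complex^'n::finite \<Rightarrow> complex^'n^'n) \<Rightarrow> 'n \<Rightarrow> 'n \<Rightarrow> 'n \<Rightarrow> 'n \<Rightarrow> complex^'n \<Rightarrow> complex" where
  "curv G i j k l z = (\<Sum>m\<in>UNIV. G z $ m $ l * curv_up G i j k m z)"

definition Q_tensor ::
  "(complex^'n::finite \<Rightarrow> complex^'n^'n) \<Rightarrow> 'n \<Rightarrow> 'n \<Rightarrow> 'n \<Rightarrow> 'n \<Rightarrow> complex^'n \<Rightarrow> complex" where
  "Q_tensor G i j k l z = curv G i j k l z
     - (\<Sum>p\<in>UNIV. \<Sum>q\<in>UNIV. metric_inv G z p q * torsion G k p j z * cnj (torsion G l q i z))"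

end

theory Submission
  imports Defs "HOL-Complex_Analysis.Cauchy_Integral_Formula"
begin

text \<open>The covering map is locally biholomorphic, because the pulled back form is nondegenerate, so
  near every point of \<open>M\<close> the potential descends to a smooth real function \<open>\<Psi>\<close> with
  \<open>\<partial>\<^sub>i \<partial>\<^sub>b\<^sub>a\<^sub>r\<^sub>j \<Psi> = C \<Psi> g\<^sub>i\<^sub>j\<close>. Differentiating this identity and writing \<open>a = \<partial> log \<Psi>\<close>, the torsion is
  \<open>T\<^sub>k\<^sub>p\<^sub>j = a\<^sub>p g\<^sub>k\<^sub>j - a\<^sub>k g\<^sub>p\<^sub>j\<close>, and the curvature \<open>R\<^sub>i\<^sub>j\<^sub>k\<^sub>l\<close> is
  \<open>C g\<^sub>i\<^sub>j g\<^sub>k\<^sub>l - a\<^sub>i cnj a\<^sub>j g\<^sub>k\<^sub>l\<close> up to terms which are symmetric in \<open>i, k\<close> and in \<open>j, l\<close>. The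
  torsion product contributes \<open>- a\<^sub>k cnj a\<^sub>l g\<^sub>i\<^sub>j\<close> and three further terms which are together
  invariant under exchanging \<open>(i, j)\<close> with \<open>(k, l)\<close>.\<close>


section \<open>Functions of class $C^k$\<close>

text \<open>The potential lives in charts of the covering, while \<open>Q_tensor\<close> is computed
  in a chart of M, so the potential has to be composed with the inverse of the coordinate expression
  of the covering map. Four derivatives must survive this: two produce the metric, two more the
  curvature. Holomorphy, however, is given only as complex differentiability at each point, so the
  smoothness of the inverse has to be earned from Cauchy's formula. Composition with a holomorphic
  map keeps the complex Hessian tensorial, because the second derivatives of the map drop out; this
  lets an identity of real two-forms become an identity of components. The symmetries used at the
  end are those of iterated Wirtinger derivatives of a single function, which calls for equality of
  mixed partials for \<open>C_k_on\<close>, a notion that speaks only of derivatives along fixed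
  vectors.\<close>

lemma frechet_derivative_eqI: "(f has_derivative D) (at x) \<Longrightarrow> frechet_derivative f (at x) = D"
  by (rule frechet_derivative_at[symmetric])

text \<open>Both functions have the same set of derivatives at \<open>z\<close>, so the choice made
  by \<open>frechet_derivative\<close> is the same, even if neither is differentiable there.\<close>

lemma frechet_derivative_cong_open:
  assumes S: "open S" "z \<in> S" and eq: "\<And>x. x \<in> S \<Longrightarrow> f x = g x"
  shows "frechet_derivative f (at z) = frechet_derivative g (at z)"
proof -
  have "(f has_derivative D) (at z) \<longleftrightarrow> (g has_derivative D) (at z)" for D
    using has_derivative_transform_within_open[OF _ S, of f D UNIV g]
      has_derivative_transform_within_open[OF _ S, of g D UNIV f] eq by auto
  then show ?thesis by (simp add: frechet_derivative_def)
qed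

lemma C_k_on_cong:
  assumes "open S" "\<And>x. x \<in> S \<Longrightarrow> f x = g x" "C_k_on k f S"
  shows "C_k_on k g S"
  using assms(2,3)
proof (induction k arbitrary: f g)
  case 0
  then show ?case using continuous_on_cong by force
next
  case (Suc k)
  have df: "f differentiable (at x)" if "x \<in> S" for x using Suc.prems that by simp
  have hd: "(g has_derivative frechet_derivative f (at x)) (at x)" if "x \<in> S" for x
    by (rule has_derivative_transform_within_open[OF _ \<open>open S\<close> that Suc.prems(1)])
       (use df[OF that] in \<open>simp add: frechet_derivative_works\<close>)
  have "C_k_on k (\<lambda>x. frechet_derivative g (at x) v) S" for v
    by (rule Suc.IH[of "\<lambda>x. frechet_derivative f (at x) v"])
       (use Suc.prems in \<open>simp_all add: frechet_derivative_eqI[OF hd]\<close>)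
  with hd show ?case by (auto simp: differentiable_def)
qed

lemma C_k_on_continuous: "C_k_on k f S \<Longrightarrow> continuous_on S f"
  by (cases k) (auto intro!: continuous_at_imp_continuous_on differentiable_imp_continuous_within)

lemma C_k_on_mono: "C_k_on k f S \<Longrightarrow> j \<le> k \<Longrightarrow> C_k_on j f S"
proof (induction j arbitrary: k f)
  case 0
  then show ?case by (simp add: C_k_on_continuous)
next
  case (Suc j)
  then obtain k' where "k = Suc k'" "j \<le> k'" by (cases k) auto
  with Suc show ?case by auto
qed

lemma C_k_on_subset: "C_k_on k f S \<Longrightarrow> T \<subseteq> S \<Longrightarrow> C_k_on k f T"
  by (induction k arbitrary: f) (auto intro: continuous_on_subset)

text \<open>The closure rules below know the derivative as an explicit formula \<open>D\<close>;
  this rule trades the chosen \<open>frechet_derivative\<close> for it.\<close>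

lemma C_k_on_SucI:
  assumes "open S" "\<And>x. x \<in> S \<Longrightarrow> (f has_derivative D x) (at x)"
    and "\<And>v. C_k_on k (\<lambda>x. D x v) S"
  shows "C_k_on (Suc k) f S"
proof -
  have "C_k_on k (\<lambda>x. frechet_derivative f (at x) v) S" for v
    by (rule C_k_on_cong[OF \<open>open S\<close> _ assms(3)[of v]])
       (simp add: frechet_derivative_eqI[OF assms(2)])
  with assms(2) show ?thesis by (auto simp: differentiable_def)
qed

lemma C_k_on_SucD:
  assumes "C_k_on (Suc k) f S"
  shows "x \<in> S \<Longrightarrow> (f has_derivative frechet_derivative f (at x)) (at x)"
    and "C_k_on k (\<lambda>x. frechet_derivative f (at x) v) S"
  using assms by (auto simp: frechet_derivative_works)

lemma C_k_on_const: "open S \<Longrightarrow> C_k_on k (\<lambda>x. c) S"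
proof (induction k arbitrary: c)
  case (Suc k)
  then show ?case by (intro C_k_on_SucI[where D = "\<lambda>x v. 0"]) auto
qed auto

lemma C_k_on_bounded_linear:
  assumes L: "bounded_linear L" and S: "open S"
  shows "C_k_on k f S \<Longrightarrow> C_k_on k (\<lambda>x. L (f x)) S"
proof (induction k arbitrary: f)
  case 0
  then show ?case using L by (simp add: bounded_linear.continuous_on)
next
  case (Suc k)
  show ?case
    by (rule C_k_on_SucI[OF S, where D = "\<lambda>x v. L (frechet_derivative f (at x) v)"])
       (use C_k_on_SucD[OF Suc.prems] Suc.IH in \<open>auto intro!: bounded_linear.has_derivative[OF L]\<close>)
qed

lemma C_k_on_add:
  assumes S: "open S"
  shows "C_k_on k f S \<Longrightarrow> C_k_on k g S \<Longrightarrow> C_k_on k (\<lambda>x. f x + g x) S"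
proof (induction k arbitrary: f g)
  case 0
  then show ?case by (simp add: continuous_on_add)
next
  case (Suc k)
  show ?case
    by (rule C_k_on_SucI[OF S, where D = "\<lambda>x v. frechet_derivative f (at x) v + frechet_derivative g (at x) v"])
       (use C_k_on_SucD[OF Suc.prems(1)] C_k_on_SucD[OF Suc.prems(2)] Suc.IH in
         \<open>auto intro!: has_derivative_add\<close>)
qed

lemma C_k_on_sum:
  assumes S: "open S"
  shows "(\<And>i. i \<in> I \<Longrightarrow> C_k_on k (f i) S) \<Longrightarrow> C_k_on k (\<lambda>x. \<Sum>i\<in>I. f i x) S"
  by (induction I rule: infinite_finite_induct)
     (auto intro!: C_k_on_const[OF S] C_k_on_add[OF S])

text \<open>A general bounded bilinear \<open>P\<close> covers complex multiplication and
  \<open>scaleR\<close> at once. The product rule stays inside the same \<open>P\<close>, which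
  closes the induction.\<close>

lemma C_k_on_bilinear:
  assumes P: "bounded_bilinear P" and S: "open S"
  shows "C_k_on k f S \<Longrightarrow> C_k_on k g S \<Longrightarrow> C_k_on k (\<lambda>x. P (f x) (g x)) S"
proof (induction k arbitrary: f g)
  case 0
  then show ?case by (simp add: bounded_bilinear.continuous_on[OF P])
next
  case (Suc k)
  note f = C_k_on_SucD[OF Suc.prems(1)] and g = C_k_on_SucD[OF Suc.prems(2)]
  show ?case
  proof (rule C_k_on_SucI[OF S])
    show "((\<lambda>x. P (f x) (g x)) has_derivative (\<lambda>v. P (f x) (frechet_derivative g (at x) v)
            + P (frechet_derivative f (at x) v) (g x))) (at x)" if "x \<in> S" for x
      by (rule bounded_bilinear.FDERIV[OF P f(1)[OF that] g(1)[OF that]])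
    show "C_k_on k (\<lambda>x. P (f x) (frechet_derivative g (at x) v)
            + P (frechet_derivative f (at x) v) (g x)) S" for v
      by (intro C_k_on_add[OF S] Suc.IH f(2) g(2) C_k_on_mono[OF Suc.prems(1)] C_k_on_mono[OF Suc.prems(2)])
         simp_all
  qed
qed

text \<open>By the chain rule the outer derivative is taken along a vector that varies with
  \<open>x\<close>, whereas \<open>C_k_on\<close> controls fixed directions only. Expanding that
  vector in \<open>Basis\<close> leaves fixed directions with \<open>C_k\<close> coefficients; this
  is why the middle space is Euclidean.\<close>

lemma C_k_on_compose:
  fixes E :: "'a::real_normed_vector \<Rightarrow> 'b::euclidean_space"
  assumes S: "open S" and T: "E ` S \<subseteq> T"
  shows "C_k_on k f T \<Longrightarrow> C_k_on k E S \<Longrightarrow> C_k_on k (\<lambda>x. f (E x)) S"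
proof (induction k arbitrary: f)
  case 0
  then show ?case using continuous_on_compose2[of T f S E] T by simp
next
  case (Suc k)
  note f = C_k_on_SucD[OF Suc.prems(1)] and E = C_k_on_SucD[OF Suc.prems(2)]
  have ET: "E x \<in> T" if "x \<in> S" for x using T that by blast
  show ?case
  proof (rule C_k_on_SucI[OF S, where D = "\<lambda>x v. \<Sum>b\<in>Basis.
      (frechet_derivative E (at x) v \<bullet> b) *\<^sub>R frechet_derivative f (at (E x)) b"])
    show "((\<lambda>x. f (E x)) has_derivative (\<lambda>v. \<Sum>b\<in>Basis. (frechet_derivative E (at x) v \<bullet> b) *\<^sub>R
        frechet_derivative f (at (E x)) b)) (at x)" if "x \<in> S" for x
    proof -
      have lin: "linear (frechet_derivative f (at (E x)))"
        using f(1)[OF ET[OF that]] has_derivative_linear by blast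
      have rep: "frechet_derivative f (at (E x)) w = (\<Sum>b\<in>Basis. (w \<bullet> b) *\<^sub>R frechet_derivative f (at (E x)) b)" for w
        using linear_sum[OF lin, of "\<lambda>b. (w \<bullet> b) *\<^sub>R b" Basis]
        by (simp only: euclidean_representation linear_cmul[OF lin])
      show ?thesis
        by (subst rep[symmetric]) (rule has_derivative_compose[OF E(1)[OF that] f(1)[OF ET[OF that]]])
    qed
    fix v
    show "C_k_on k (\<lambda>x. \<Sum>b\<in>Basis. (frechet_derivative E (at x) v \<bullet> b) *\<^sub>R frechet_derivative f (at (E x)) b) S"
    proof (rule C_k_on_sum[OF S])
      fix b :: 'b
      have "C_k_on k (\<lambda>x. frechet_derivative f (at (E x)) b) S"
        by (rule Suc.IH[OF f(2) C_k_on_mono[OF Suc.prems(2)]]) simp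
      with E(2) show "C_k_on k (\<lambda>x. (frechet_derivative E (at x) v \<bullet> b) *\<^sub>R frechet_derivative f (at (E x)) b) S"
        by (intro C_k_on_bilinear[OF bounded_bilinear_scaleR S] C_k_on_bounded_linear[OF bounded_linear_inner_left S])
    qed
  qed
qed

section \<open>Symmetry of second derivatives\<close>

text \<open>The mean value theorem is applied twice: along \<open>u\<close> to the difference of
  \<open>f\<close> over two opposite sides of the parallelogram, then along \<open>v\<close> to the
  derivative in direction \<open>u\<close>.\<close>

lemma second_difference_mean_value:
  fixes f :: "'a::real_normed_vector \<Rightarrow> real"
  assumes f: "\<And>x. x \<in> S \<Longrightarrow> f differentiable (at x)"
    and fu: "\<And>x. x \<in> S \<Longrightarrow> (\<lambda>y. frechet_derivative f (at y) u) differentiable (at x)"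
    and S: "\<And>a b. 0 \<le> a \<Longrightarrow> a \<le> s \<Longrightarrow> 0 \<le> b \<Longrightarrow> b \<le> s \<Longrightarrow> z + a *\<^sub>R u + b *\<^sub>R v \<in> S"
    and s: "s > 0"
  shows "\<exists>a b. 0 < a \<and> a < s \<and> 0 < b \<and> b < s \<and>
    f (z + s *\<^sub>R u + s *\<^sub>R v) - f (z + s *\<^sub>R u) - f (z + s *\<^sub>R v) + f z
      = s\<^sup>2 * frechet_derivative (\<lambda>y. frechet_derivative f (at y) u) (at (z + a *\<^sub>R u + b *\<^sub>R v)) v"
proof -
  \<comment> \<open>The summand \<open>0 *\<^sub>R v\<close> makes both terms instances of
    \<open>d1\<close>, with \<open>b = s\<close> and \<open>b = 0\<close>.\<close>
  define h where "h t = f (z + t *\<^sub>R u + s *\<^sub>R v) - f (z + t *\<^sub>R u + 0 *\<^sub>R v)" for t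
  let ?fu = "\<lambda>y. frechet_derivative f (at y) u"
  have d1: "((\<lambda>t. f (z + t *\<^sub>R u + b *\<^sub>R v)) has_real_derivative ?fu (z + t *\<^sub>R u + b *\<^sub>R v)) (at t)"
    if "0 \<le> t" "t \<le> s" "0 \<le> b" "b \<le> s" for t b
  proof -
    have D: "(f has_derivative frechet_derivative f (at (z + t *\<^sub>R u + b *\<^sub>R v))) (at (z + t *\<^sub>R u + b *\<^sub>R v))"
      using f S that by (simp add: frechet_derivative_works)
    have "((\<lambda>t. z + t *\<^sub>R u + b *\<^sub>R v) has_derivative (\<lambda>t. t *\<^sub>R u)) (at t)"
      by (auto intro!: derivative_eq_intros)
    from has_derivative_compose[OF this D] show ?thesis
      by (rule has_derivative_imp_has_field_derivative)
         (simp add: linear_cmul[OF has_derivative_linear[OF D]])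
  qed
  have d2: "((\<lambda>b. ?fu (z + t *\<^sub>R u + b *\<^sub>R v)) has_real_derivative
      frechet_derivative ?fu (at (z + t *\<^sub>R u + b *\<^sub>R v)) v) (at b)"
    if "0 \<le> t" "t \<le> s" "0 \<le> b" "b \<le> s" for t b
  proof -
    have D: "(?fu has_derivative frechet_derivative ?fu (at (z + t *\<^sub>R u + b *\<^sub>R v))) (at (z + t *\<^sub>R u + b *\<^sub>R v))"
      using fu S that by (simp add: frechet_derivative_works)
    have "((\<lambda>b. z + t *\<^sub>R u + b *\<^sub>R v) has_derivative (\<lambda>b. b *\<^sub>R v)) (at b)"
      by (auto intro!: derivative_eq_intros)
    from has_derivative_compose[OF this D] show ?thesis
      by (rule has_derivative_imp_has_field_derivative)
         (simp add: linear_cmul[OF has_derivative_linear[OF D]])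
  qed
  have "(h has_real_derivative (?fu (z + t *\<^sub>R u + s *\<^sub>R v) - ?fu (z + t *\<^sub>R u + 0 *\<^sub>R v))) (at t)"
    if "0 \<le> t" "t \<le> s" for t
    unfolding h_def using that s by (intro DERIV_diff d1) auto
  from MVT2[OF s this] obtain a where a: "0 < a" "a < s"
    "h s - h 0 = s * (?fu (z + a *\<^sub>R u + s *\<^sub>R v) - ?fu (z + a *\<^sub>R u + 0 *\<^sub>R v))" by auto
  from MVT2[OF s d2, of a] a obtain b where b: "0 < b" "b < s"
    "?fu (z + a *\<^sub>R u + s *\<^sub>R v) - ?fu (z + a *\<^sub>R u + 0 *\<^sub>R v)
      = s * frechet_derivative ?fu (at (z + a *\<^sub>R u + b *\<^sub>R v)) v" by auto
  have "f (z + s *\<^sub>R u + s *\<^sub>R v) - f (z + s *\<^sub>R u) - f (z + s *\<^sub>R v) + f z = h s - h 0"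
    by (simp add: h_def)
  also have "\<dots> = s\<^sup>2 * frechet_derivative ?fu (at (z + a *\<^sub>R u + b *\<^sub>R v)) v"
    using a(3) b(3) by (simp add: power2_eq_square)
  finally show ?thesis using a b by blast
qed

text \<open>The second difference over a parallelogram is symmetric in \<open>u\<close> and
  \<open>v\<close>, so each mixed derivative takes the same value at some point near
  \<open>z\<close>. Continuity of both at \<open>z\<close> then forces equality in the limit of
  small parallelograms.\<close>

lemma second_derivative_symmetric_real:
  fixes f :: "'a::real_normed_vector \<Rightarrow> real"
  assumes S: "open S" and z: "z \<in> S" and f: "C_k_on 2 f S"
  shows "frechet_derivative (\<lambda>y. frechet_derivative f (at y) u) (at z) v
       = frechet_derivative (\<lambda>y. frechet_derivative f (at y) v) (at z) u"
    (is "?A z = ?B z")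
proof -
  have f': "C_k_on (Suc (Suc 0)) f S" using f by (simp add: numeral_2_eq_2)
  have d: "f differentiable (at x)" "(\<lambda>y. frechet_derivative f (at y) w) differentiable (at x)"
    if "x \<in> S" for x w using f' that by auto
  have cont: "isCont ?A z" "isCont ?B z"
    using f' S z by (auto simp: continuous_on_eq_continuous_at)
  define pt where "pt a b = z + a *\<^sub>R u + b *\<^sub>R v" for a b :: real
  obtain r where r: "r > 0" "ball z r \<subseteq> S" using S z open_contains_ball by blast
  \<comment> \<open>All points of the parallelogram of size \<open>s\<close> lie within
    \<open>s * K\<close> of \<open>z\<close>; the summand 1 keeps \<open>K\<close> positive when
    both vectors vanish.\<close>
  define K where "K = norm u + norm v + 1"
  have K: "K > 0" by (simp add: K_def add_nonneg_pos)
  have pt: "dist z (pt a b) < e" if "0 \<le> a" "a \<le> s" "0 \<le> b" "b \<le> s" "s * K < e" "s > 0" for a b s e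
  proof -
    have "dist z (pt a b) = norm (a *\<^sub>R u + b *\<^sub>R v)"
      by (metis add.assoc add_diff_cancel_left' dist_commute dist_norm pt_def)
    also have "\<dots> \<le> norm (a *\<^sub>R u) + norm (b *\<^sub>R v)" by (rule norm_triangle_ineq)
    also have "\<dots> \<le> s * norm u + s * norm v" using that by (auto intro!: add_mono mult_right_mono)
    also have "\<dots> < e" using that by (simp add: K_def algebra_simps)
    finally show ?thesis .
  qed
  have "\<bar>?A z - ?B z\<bar> \<le> 0"
  proof (rule field_le_epsilon)
    fix e :: real assume e: "e > 0"
    then have e2: "e / 2 > 0" by simp
    obtain d1 where d1: "d1 > 0" "\<And>x. dist x z < d1 \<Longrightarrow> dist (?A x) (?A z) < e / 2"
      using cont(1) e2 unfolding continuous_at_eps_delta by blast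
    obtain d2 where d2: "d2 > 0" "\<And>x. dist x z < d2 \<Longrightarrow> dist (?B x) (?B z) < e / 2"
      using cont(2) e2 unfolding continuous_at_eps_delta by blast
    define m where "m = min r (min d1 d2)"
    define s where "s = m / (2 * K)"
    have m: "m > 0" using r d1 d2 by (simp add: m_def)
    have s: "s > 0" "s * K < m" using m K by (auto simp: s_def)
    have near: "dist z (pt a b) < m" if "0 \<le> a" "a \<le> s" "0 \<le> b" "b \<le> s" for a b
      using pt that s by blast
    have inS: "pt a b \<in> S" if "0 \<le> a" "a \<le> s" "0 \<le> b" "b \<le> s" for a b
      using near[OF that] r by (auto simp: m_def subset_iff)
    obtain a b where ab: "0 < a" "a < s" "0 < b" "b < s"
      "f (z + s *\<^sub>R u + s *\<^sub>R v) - f (z + s *\<^sub>R u) - f (z + s *\<^sub>R v) + f z = s\<^sup>2 * ?A (pt a b)"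
      using second_difference_mean_value[of S f u s z v] d inS s(1) unfolding pt_def by blast
    have inS': "z + a *\<^sub>R v + b *\<^sub>R u \<in> S" if "0 \<le> a" "a \<le> s" "0 \<le> b" "b \<le> s" for a b
      using inS[of b a] that by (simp add: pt_def add_ac)
    obtain a' b' where ab': "0 < a'" "a' < s" "0 < b'" "b' < s"
      "f (z + s *\<^sub>R v + s *\<^sub>R u) - f (z + s *\<^sub>R v) - f (z + s *\<^sub>R u) + f z = s\<^sup>2 * ?B (z + a' *\<^sub>R v + b' *\<^sub>R u)"
      using second_difference_mean_value[of S f v s z u] d inS' s(1) by blast
    have c: "z + s *\<^sub>R v + s *\<^sub>R u = z + s *\<^sub>R u + s *\<^sub>R v" "z + a' *\<^sub>R v + b' *\<^sub>R u = pt b' a'"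
      by (simp_all add: pt_def add_ac)
    have "s\<^sup>2 * ?A (pt a b) = s\<^sup>2 * ?B (pt b' a')"
      using ab(5) ab'(5) unfolding c by linarith
    then have eq: "?A (pt a b) = ?B (pt b' a')" using s(1) by simp
    have "dist (?A (pt a b)) (?A z) < e / 2"
      by (rule d1) (use near[of a b] ab in \<open>auto simp: m_def dist_commute\<close>)
    moreover have "dist (?B (pt b' a')) (?B z) < e / 2"
      by (rule d2) (use near[of b' a'] ab' in \<open>auto simp: m_def dist_commute\<close>)
    ultimately show "\<bar>?A z - ?B z\<bar> \<le> 0 + e" using eq unfolding dist_real_def by linarith
  qed
  then show ?thesis by simp
qed

lemma second_derivative_symmetric:
  fixes f :: "'a::real_normed_vector \<Rightarrow> 'b::euclidean_space"
  assumes S: "open S" and z: "z \<in> S" and f: "C_k_on 2 f S"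
  shows "frechet_derivative (\<lambda>y. frechet_derivative f (at y) u) (at z) v
       = frechet_derivative (\<lambda>y. frechet_derivative f (at y) v) (at z) u"
proof (rule euclidean_eqI)
  fix b :: 'b assume "b \<in> Basis"
  have f': "C_k_on (Suc (Suc 0)) f S" using f by (simp add: numeral_2_eq_2)
  note D1 = C_k_on_SucD[OF f'] and D2 = C_k_on_SucD[OF C_k_on_SucD(2)[OF f']]
  have in1: "((\<lambda>x. f x \<bullet> b) has_derivative (\<lambda>w. frechet_derivative f (at x) w \<bullet> b)) (at x)"
    if "x \<in> S" for x using D1(1)[OF that] by (rule has_derivative_inner_left)
  have in2: "frechet_derivative (\<lambda>y. frechet_derivative (\<lambda>x. f x \<bullet> b) (at y) u) (at z) v
      = frechet_derivative (\<lambda>y. frechet_derivative f (at y) u) (at z) v \<bullet> b" for u v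
  proof -
    have "((\<lambda>y. frechet_derivative f (at y) u \<bullet> b) has_derivative
       (\<lambda>w. frechet_derivative (\<lambda>y. frechet_derivative f (at y) u) (at z) w \<bullet> b)) (at z)"
      using D2(1)[OF z] by (rule has_derivative_inner_left)
    then have "((\<lambda>y. frechet_derivative (\<lambda>x. f x \<bullet> b) (at y) u) has_derivative
       (\<lambda>w. frechet_derivative (\<lambda>y. frechet_derivative f (at y) u) (at z) w \<bullet> b)) (at z)"
      by (rule has_derivative_transform_within_open[OF _ S z])
         (simp add: frechet_derivative_eqI[OF in1])
    then show ?thesis by (simp add: frechet_derivative_eqI)
  qed
  show "frechet_derivative (\<lambda>y. frechet_derivative f (at y) u) (at z) v \<bullet> b
       = frechet_derivative (\<lambda>y. frechet_derivative f (at y) v) (at z) u \<bullet> b"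
    using second_derivative_symmetric_real[OF S z, of "\<lambda>x. f x \<bullet> b" u v]
      C_k_on_bounded_linear[OF bounded_linear_inner_left S f] in2 by simp
qed

section \<open>Holomorphic maps of several variables are smooth\<close>

text \<open>Scalar counterpart of \<open>hol_map_on\<close>, to which Cauchy's formula in one
  complex variable applies directly.\<close>

definition hol_fun_on :: "(complex^'n::finite \<Rightarrow> complex) \<Rightarrow> (complex^'n) set \<Rightarrow> bool" where
  "hol_fun_on u S \<longleftrightarrow> (\<forall>z\<in>S. \<exists>D. (u has_derivative D) (at z) \<and> (\<forall>a v. D (a *s v) = a * D v))"

lemma norm_vector_scalar_mult: "norm (a *s v) = cmod a * norm v" for v :: "complex^'n::finite"
  by (simp add: norm_vec_def vector_scalar_mult_def norm_mult L2_set_right_distrib)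

lemma hol_fun_onD:
  assumes "hol_fun_on u S" "z \<in> S"
  shows "(u has_derivative frechet_derivative u (at z)) (at z)"
    and "frechet_derivative u (at z) (a *s v) = a * frechet_derivative u (at z) v"
proof -
  from assms obtain D where D: "(u has_derivative D) (at z)" "\<And>a v. D (a *s v) = a * D v"
    unfolding hol_fun_on_def by blast
  show "(u has_derivative frechet_derivative u (at z)) (at z)"
    and "frechet_derivative u (at z) (a *s v) = a * frechet_derivative u (at z) v"
    using D by (simp_all add: frechet_derivative_eqI[OF D(1)])
qed

lemma hol_fun_on_continuous_on: "hol_fun_on u S \<Longrightarrow> continuous_on S u"
  by (auto intro!: continuous_at_imp_continuous_on has_derivative_continuous hol_fun_onD(1))

lemma bounded_linear_smult_left: "bounded_linear (\<lambda>t. t *s v)" for v :: "complex^'n::finite"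
  by (rule bounded_linear_intro[of _ "norm v"])
     (auto simp: vec_eq_iff algebra_simps norm_vector_scalar_mult)

text \<open>Cauchy's formula for the first derivative at 0 of the one-variable function
  \<open>h t = u (z + t *s v)\<close> over the circle of radius \<open>r\<close>. The velocity of
  the circle is \<open>2 * pi * \<i>\<close> times the circle point, which cancels one of the two
  powers in the denominator.\<close>

lemma frechet_derivative_Cauchy:
  fixes u :: "complex^'n::finite \<Rightarrow> complex"
  assumes u: "hol_fun_on u S" and r: "r > 0"
    and S: "\<And>t. cmod t \<le> r \<Longrightarrow> z + t *s v \<in> S"
  shows "frechet_derivative u (at z) v = integral (cbox 0 1)
    (\<lambda>s. u (z + (r * exp (2 * pi * \<i> * of_real s)) *s v) / (r * exp (2 * pi * \<i> * of_real s)))"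
proof -
  define h where "h t = u (z + t *s v)" for t
  define e where "e s = r * exp (2 * pi * \<i> * of_real s)" for s :: real
  have dh: "(h has_field_derivative frechet_derivative u (at (z + t *s v)) v) (at t)" if "cmod t \<le> r" for t
  proof -
    have "((\<lambda>t. z + t *s v) has_derivative (\<lambda>t. 0 + t *s v)) (at t)"
      by (intro has_derivative_add has_derivative_const bounded_linear_imp_has_derivative bounded_linear_smult_left)
    from has_derivative_compose[OF this hol_fun_onD(1)[OF u S[OF that]]]
    show ?thesis unfolding h_def has_field_derivative_def
      by (rule has_derivative_eq_rhs) (simp add: fun_eq_iff hol_fun_onD(2)[OF u S[OF that]] mult.commute)
  qed
  have "continuous_on (cball 0 r) h"
    using dh by (auto intro!: continuous_at_imp_continuous_on DERIV_isCont)
  moreover have "h holomorphic_on ball 0 r"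
    unfolding holomorphic_on_open[OF open_ball] using dh by (meson less_imp_le mem_ball_0)
  ultimately have "((\<lambda>w. h w / (w - 0) ^ Suc 1) has_contour_integral (2 * pi * \<i>) / fact 1 * (deriv ^^ 1) h 0) (circlepath 0 r)"
    using r by (intro Cauchy_has_contour_integral_higher_derivative_circlepath) auto
  moreover have "deriv h 0 = frechet_derivative u (at z) v"
    using dh[of 0] r by (simp add: DERIV_imp_deriv)
  ultimately have "((\<lambda>s. h (circlepath 0 r s) / (circlepath 0 r s)\<^sup>2 *
      vector_derivative (circlepath 0 r) (at s within {0..1})) has_integral
      2 * pi * \<i> * frechet_derivative u (at z) v) {0..1}"
    by (simp add: has_contour_integral_def numeral_2_eq_2)
  moreover have "vector_derivative (circlepath 0 r) (at s within {0..1}) = 2 * pi * \<i> * e s"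
    if "s \<in> {0..1}" for s
    using vector_derivative_circlepath01[of s 0 r] that by (simp add: e_def mult_ac)
  moreover have "circlepath 0 r s = e s" for s by (simp add: circlepath e_def)
  moreover have "e s \<noteq> 0" for s using r by (simp add: e_def)
  ultimately have "((\<lambda>s. 2 * pi * \<i> * (h (e s) / e s)) has_integral
      2 * pi * \<i> * frechet_derivative u (at z) v) {0..1}"
    by (elim has_integral_eq[rotated]) (simp add: power2_eq_square)
  from has_integral_mult_right[OF this, of "1 / (2 * pi * \<i>)"]
  have "((\<lambda>s. h (e s) / e s) has_integral frechet_derivative u (at z) v) {0..1}" by simp
  then show ?thesis by (simp add: h_def e_def integral_unique)
qed

text \<open>One radius serves all centres near \<open>z\<close>, so that Cauchy's formula integrates
  over the same parameter circle for all of them and can be differentiated in the centre.\<close>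

lemma smult_neighbourhood:
  fixes v :: "complex^'n::finite"
  assumes "open S" "z \<in> S"
  obtains d r where "d > 0" "r > 0" "\<And>x t. x \<in> ball z d \<Longrightarrow> cmod t \<le> r \<Longrightarrow> x + t *s v \<in> S"
proof -
  obtain R where R: "R > 0" "ball z R \<subseteq> S" using assms open_contains_ball by blast
  \<comment> \<open>Half of \<open>R\<close> is left for the displacement \<open>t *s v\<close>, the
    other half for the centre; adding 1 to the norm admits \<open>v = 0\<close>.\<close>
  define r where "r = R / (2 * (norm v + 1))"
  have v: "norm v + 1 > 0" by (simp add: add_nonneg_pos)
  have "x + t *s v \<in> S" if "x \<in> ball z (R / 2)" "cmod t \<le> r" for x t
  proof -
    have "norm (t *s v) \<le> r * norm v"
      using that by (simp add: norm_vector_scalar_mult mult_right_mono)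
    also have "\<dots> \<le> r * (norm v + 1)" using R v by (intro mult_left_mono) (auto simp: r_def)
    also have "\<dots> = R / 2" using v by (simp add: r_def field_simps)
    finally have "norm (t *s v) \<le> R / 2" .
    moreover have "dist z (x + t *s v) \<le> dist z x + norm (t *s v)"
      using dist_triangle[of z "x + t *s v" x] by (simp add: dist_norm)
    ultimately show ?thesis using that R by auto
  qed
  then show thesis using that[of "R / 2" r] R v by (simp add: r_def)
qed

lemma continuous_on_circle_point:
  fixes v :: "complex^'n::finite"
  assumes f: "continuous_on S f" and e: "continuous_on UNIV e"
    and S: "\<And>x s. x \<in> U \<Longrightarrow> x + e s *s v \<in> S" and "\<And>s. e s \<noteq> 0"
  shows "continuous_on (U \<times> T) (\<lambda>p. f (fst p + e (snd p) *s v) / e (snd p))"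
proof -
  have *: "continuous_on (U \<times> T) (\<lambda>p. e (snd p))"
    by (rule continuous_on_compose2[OF e continuous_on_snd[OF continuous_on_id]]) simp
  have "continuous_on (U \<times> T) (\<lambda>p. fst p + e (snd p) *s v)"
    by (rule continuous_on_add[OF continuous_on_fst[OF continuous_on_id]
          bounded_linear.continuous_on[OF bounded_linear_smult_left *]])
  then have "continuous_on (U \<times> T) (\<lambda>p. f (fst p + e (snd p) *s v))"
    by (rule continuous_on_compose2[OF f]) (use S in auto)
  then show ?thesis using * assms(4) by (intro continuous_on_divide) auto
qed

text \<open>Locally the derivative is an integral over a compact parameter interval whose integrand
  is jointly continuous in the centre and the parameter.\<close>

lemma frechet_derivative_hol_continuous:
  assumes u: "hol_fun_on u S" and S: "open S"
  shows "continuous_on S (\<lambda>z. frechet_derivative u (at z) v)"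
proof (rule continuous_at_imp_continuous_on, rule ballI)
  fix z assume "z \<in> S"
  obtain d r where dr: "d > 0" "r > 0" "\<And>x t. x \<in> ball z d \<Longrightarrow> cmod t \<le> r \<Longrightarrow> x + t *s v \<in> S"
    by (rule smult_neighbourhood[OF S \<open>z \<in> S\<close>, of v]) blast
  define e where "e s = r * exp (2 * pi * \<i> * of_real s)" for s :: real
  have e: "cmod (e s) \<le> r" "e s \<noteq> 0" for s using dr by (auto simp: e_def norm_mult)
  have ce: "continuous_on A e" for A unfolding e_def by (intro continuous_intros)
  have "continuous_on (ball z d \<times> cbox 0 1) (\<lambda>(x, s). u (x + e s *s v) / e s)"
    unfolding split_beta
    by (rule continuous_on_circle_point[OF hol_fun_on_continuous_on[OF u] ce dr(3)[OF _ e(1)] e(2)])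
  then have "continuous_on (ball z d) (\<lambda>x. integral (cbox 0 1) (\<lambda>s. u (x + e s *s v) / e s))"
    by (rule integral_continuous_on_param)
  moreover have "integral (cbox 0 1) (\<lambda>s. u (x + e s *s v) / e s) = frechet_derivative u (at x) v"
    if "x \<in> ball z d" for x
    unfolding e_def by (rule frechet_derivative_Cauchy[OF u dr(2) dr(3)[OF that], symmetric])
  ultimately have "continuous_on (ball z d) (\<lambda>x. frechet_derivative u (at x) v)"
    by (rule continuous_on_cong[THEN iffD1, OF refl, rotated]) 
  then show "isCont (\<lambda>z. frechet_derivative u (at z) v) z"
    using dr(1) by (simp add: continuous_on_eq_continuous_at)
qed

text \<open>Holomorphy only means complex differentiability at every point. Cauchy's formula on the disc
  \<open>z + t v\<close> writes the derivative along \<open>v\<close> as an integral of values of \<open>u\<close>, so that it is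
  first continuous, and then differentiable by the Leibniz rule.\<close>

lemma hol_fun_on_frechet_derivative:
  assumes u: "hol_fun_on u S" and S: "open S"
  shows "hol_fun_on (\<lambda>z. frechet_derivative u (at z) v) S"
  unfolding hol_fun_on_def
proof
  fix z assume "z \<in> S"
  obtain d r where dr: "d > 0" "r > 0" "\<And>x t. x \<in> ball z d \<Longrightarrow> cmod t \<le> r \<Longrightarrow> x + t *s v \<in> S"
    by (rule smult_neighbourhood[OF S \<open>z \<in> S\<close>, of v]) blast
  define e where "e s = r * exp (2 * pi * \<i> * of_real s)" for s :: real
  have e: "cmod (e s) \<le> r" "e s \<noteq> 0" for s using dr by (auto simp: e_def norm_mult)
  have ce: "continuous_on A e" for A unfolding e_def by (intro continuous_intros)
  define D where "D x s w = frechet_derivative u (at (x + e s *s v)) w / e s" for x s w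
  have du: "(u has_derivative frechet_derivative u (at (x + e s *s v))) (at (x + e s *s v))"
    if "x \<in> ball z d" for x s using hol_fun_onD(1)[OF u dr(3)[OF that e(1)]] .
  have der: "((\<lambda>x. u (x + e s *s v) / e s) has_derivative D x s) (at x)" if "x \<in> ball z d" for x s
  proof -
    have "((\<lambda>x. x + e s *s v) has_derivative (\<lambda>w. w)) (at x)"
      by (auto intro!: derivative_eq_intros)
    from has_derivative_compose[OF this du[OF that]]
    show ?thesis unfolding D_def divide_inverse by (rule has_derivative_mult_left)
  qed
  have bl: "bounded_linear (D x s)" if "x \<in> ball z d" for x s
    using der[OF that] has_derivative_bounded_linear by blast
  \<comment> \<open>The Leibniz rule needs the derivative of the integrand as a continuous map into
    the space of bounded linear maps. In finite dimension continuity can be tested on each vector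
    \<open>w\<close>, where the preceding continuity lemma applies.\<close>
  define B where "B x s = Blinfun (D x s)" for x s
  have B: "blinfun_apply (B x s) = D x s" if "x \<in> ball z d" for x s
    unfolding B_def using bl[OF that] by (rule bounded_linear_Blinfun_apply)
  have contB: "continuous_on (ball z d \<times> cbox 0 1) (\<lambda>(x, s). B x s)"
  proof (rule continuous_on_blinfun_componentwise)
    fix w :: "complex^'a"
    have "continuous_on (ball z d \<times> cbox 0 1) (\<lambda>p. D (fst p) (snd p) w)"
      unfolding D_def
      by (rule continuous_on_circle_point[OF frechet_derivative_hol_continuous[OF u S] ce dr(3)[OF _ e(1)] e(2)])
    then show "continuous_on (ball z d \<times> cbox 0 1) (\<lambda>p. blinfun_apply (case p of (x, s) \<Rightarrow> B x s) w)"
      by (rule continuous_on_cong[THEN iffD1, OF refl, rotated]) (clarsimp simp: B)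
  qed
  have "((\<lambda>x. integral (cbox 0 1) (\<lambda>s. u (x + e s *s v) / e s)) has_derivative
      blinfun_apply (integral (cbox 0 1) (B z))) (at z within ball z d)"
  proof (rule leibniz_rule[OF _ _ contB])
    show "((\<lambda>x. u (x + e s *s v) / e s) has_derivative blinfun_apply (B x s)) (at x within ball z d)"
      if "x \<in> ball z d" for x s
      using der[OF that] by (simp add: B[OF that] has_derivative_at_withinI)
    show "(\<lambda>s. u (x + e s *s v) / e s) integrable_on cbox 0 1" if "x \<in> ball z d" for x
    proof (rule integrable_continuous)
      have "continuous_on (ball z d \<times> cbox 0 1) (\<lambda>p. u (fst p + e (snd p) *s v) / e (snd p))"
        by (rule continuous_on_circle_point[OF hol_fun_on_continuous_on[OF u] ce dr(3)[OF _ e(1)] e(2)])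
      from continuous_on_compose2[OF this, of "cbox 0 1" "\<lambda>s. (x, s)"] that
      show "continuous_on (cbox 0 1) (\<lambda>s. u (x + e s *s v) / e s)"
        by (simp add: continuous_on_Pair continuous_on_const continuous_on_id image_subset_iff)
    qed
  qed (use dr in auto)
  then have "((\<lambda>x. integral (cbox 0 1) (\<lambda>s. u (x + e s *s v) / e s)) has_derivative
      blinfun_apply (integral (cbox 0 1) (B z))) (at z)"
    using dr(1) by (simp add: at_within_open[of z "ball z d"])
  then have "((\<lambda>x. frechet_derivative u (at x) v) has_derivative
      blinfun_apply (integral (cbox 0 1) (B z))) (at z)"
  proof (rule has_derivative_transform_within_open[of _ _ _ UNIV "ball z d"])
    show "integral (cbox 0 1) (\<lambda>s. u (x + e s *s v) / e s) = frechet_derivative u (at x) v"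
      if "x \<in> ball z d" for x
      unfolding e_def by (rule frechet_derivative_Cauchy[OF u dr(2) dr(3)[OF that], symmetric])
  qed (use dr in auto)
  \<comment> \<open>Evaluation at a vector is bounded linear, hence passes through the integral;
    complex homogeneity is then inherited from the integrand.\<close>
  moreover have "blinfun_apply (integral (cbox 0 1) (B z)) (a *s w) = a * blinfun_apply (integral (cbox 0 1) (B z)) w" for a w
  proof -
    have zb: "z \<in> ball z d" using dr by simp
    have "continuous_on (cbox 0 1) (B z)"
      using continuous_on_compose2[OF contB, of "cbox 0 1" "\<lambda>s. (z, s)"] zb
      by (simp add: continuous_on_Pair continuous_on_const continuous_on_id image_subset_iff)
    then have int: "B z integrable_on cbox 0 1" by (rule integrable_continuous)
    have app: "blinfun_apply (integral (cbox 0 1) (B z)) w = integral (cbox 0 1) (\<lambda>s. D z s w)" for w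
      using integral_linear[OF int blinfun.bounded_linear_left[of w]] by (simp add: o_def B[OF zb])
    have "D z s (a *s w) = a * D z s w" for s
      unfolding D_def using hol_fun_onD(2)[OF u dr(3)[OF zb e(1)]] by simp
    then show ?thesis unfolding app by simp
  qed
  ultimately show "\<exists>D. ((\<lambda>z. frechet_derivative u (at z) v) has_derivative D) (at z) \<and>
      (\<forall>a v. D (a *s v) = a * D v)" by blast
qed

text \<open>The derivative along a fixed vector is again holomorphic, so the induction hypothesis
  applies to it.\<close>

lemma hol_fun_on_C_k_on: "hol_fun_on u S \<Longrightarrow> open S \<Longrightarrow> C_k_on k u S"
proof (induction k arbitrary: u)
  case (Suc k)
  then show ?case
    by (intro C_k_on_SucI[OF \<open>open S\<close> hol_fun_onD(1)]) (auto intro: hol_fun_on_frechet_derivative)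
qed (simp add: hol_fun_on_continuous_on)

lemma hol_map_onD:
  assumes "hol_map_on f S" "z \<in> S"
  shows "(f has_derivative frechet_derivative f (at z)) (at z)"
    and "frechet_derivative f (at z) (a *s v) = a *s frechet_derivative f (at z) v"
proof -
  from assms obtain D where D: "(f has_derivative D) (at z)" "\<And>a v. D (a *s v) = a *s D v"
    unfolding hol_map_on_def by blast
  show "(f has_derivative frechet_derivative f (at z)) (at z)"
    and "frechet_derivative f (at z) (a *s v) = a *s frechet_derivative f (at z) v"
    using D by (simp_all add: frechet_derivative_eqI[OF D(1)])
qed

lemma hol_map_on_component: "hol_map_on f S \<Longrightarrow> hol_fun_on (\<lambda>z. f z $ i) S"
  unfolding hol_fun_on_def
proof
  fix z assume f: "hol_map_on f S" and z: "z \<in> S"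
  have "((\<lambda>z. f z $ i) has_derivative (\<lambda>v. frechet_derivative f (at z) v $ i)) (at z)"
    by (rule bounded_linear.has_derivative[OF bounded_linear_vec_nth hol_map_onD(1)[OF f z]])
  then show "\<exists>D. ((\<lambda>z. f z $ i) has_derivative D) (at z) \<and> (\<forall>a v. D (a *s v) = a * D v)"
    by (intro exI[of _ "\<lambda>v. frechet_derivative f (at z) v $ i"]) (simp add: hol_map_onD(2)[OF f z])
qed

lemma hol_map_on_C_k_on:
  assumes "hol_map_on f S" "open S"
  shows "C_k_on k f S"
proof -
  have "C_k_on k (\<lambda>z. \<Sum>i\<in>UNIV. f z $ i *s axis i 1) S"
    by (intro C_k_on_sum[OF assms(2)] C_k_on_bounded_linear[OF bounded_linear_smult_left assms(2)]
        hol_fun_on_C_k_on hol_map_on_component assms)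
  then show ?thesis by (simp add: basis_expansion)
qed

section \<open>Wirtinger calculus\<close>

lemma dz_cong:
  assumes "open S" "z \<in> S" "\<And>x. x \<in> S \<Longrightarrow> f x = g x"
  shows "dz i f z = dz i g z" "dzbar i f z = dzbar i g z"
  using frechet_derivative_cong_open[OF assms] by (simp_all add: dz_def dzbar_def)

lemma dz_cmult:
  assumes "f differentiable (at z)"
  shows "dz i (\<lambda>x. c * f x) z = c * dz i f z" "dzbar i (\<lambda>x. c * f x) z = c * dzbar i f z"
proof -
  have "((\<lambda>x. c * f x) has_derivative (\<lambda>v. c * frechet_derivative f (at z) v)) (at z)"
    using assms by (intro has_derivative_mult_right) (simp add: frechet_derivative_works)
  then show "dz i (\<lambda>x. c * f x) z = c * dz i f z" "dzbar i (\<lambda>x. c * f x) z = c * dzbar i f z"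
    by (simp_all add: dz_def dzbar_def frechet_derivative_eqI algebra_simps)
qed

lemma dz_mult:
  assumes "f differentiable (at z)" "g differentiable (at z)"
  shows "dz i (\<lambda>x. f x * g x) z = f z * dz i g z + dz i f z * g z"
    and "dzbar i (\<lambda>x. f x * g x) z = f z * dzbar i g z + dzbar i f z * g z"
proof -
  have "((\<lambda>x. f x * g x) has_derivative
      (\<lambda>v. f z * frechet_derivative g (at z) v + frechet_derivative f (at z) v * g z)) (at z)"
    using assms by (intro has_derivative_mult) (simp_all add: frechet_derivative_works)
  then show "dz i (\<lambda>x. f x * g x) z = f z * dz i g z + dz i f z * g z"
    and "dzbar i (\<lambda>x. f x * g x) z = f z * dzbar i g z + dzbar i f z * g z"
    by (simp_all add: dz_def dzbar_def frechet_derivative_eqI field_simps)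
qed

lemma dz_add:
  assumes "f differentiable (at z)" "g differentiable (at z)"
  shows "dz i (\<lambda>x. f x + g x) z = dz i f z + dz i g z"
    and "dzbar i (\<lambda>x. f x + g x) z = dzbar i f z + dzbar i g z"
proof -
  have "((\<lambda>x. f x + g x) has_derivative
      (\<lambda>v. frechet_derivative f (at z) v + frechet_derivative g (at z) v)) (at z)"
    using assms by (intro has_derivative_add) (simp_all add: frechet_derivative_works)
  then show "dz i (\<lambda>x. f x + g x) z = dz i f z + dz i g z"
    and "dzbar i (\<lambda>x. f x + g x) z = dzbar i f z + dzbar i g z"
    by (simp_all add: dz_def dzbar_def frechet_derivative_eqI field_simps)
qed

lemma dz_sum:
  assumes "\<And>m. m \<in> I \<Longrightarrow> f m differentiable (at z)"
  shows "dz i (\<lambda>x. \<Sum>m\<in>I. f m x) z = (\<Sum>m\<in>I. dz i (f m) z)"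
    and "dzbar i (\<lambda>x. \<Sum>m\<in>I. f m x) z = (\<Sum>m\<in>I. dzbar i (f m) z)"
proof -
  have "((\<lambda>x. \<Sum>m\<in>I. f m x) has_derivative (\<lambda>v. \<Sum>m\<in>I. frechet_derivative (f m) (at z) v)) (at z)"
    using assms by (intro has_derivative_sum) (simp add: frechet_derivative_works)
  then show "dz i (\<lambda>x. \<Sum>m\<in>I. f m x) z = (\<Sum>m\<in>I. dz i (f m) z)"
    and "dzbar i (\<lambda>x. \<Sum>m\<in>I. f m x) z = (\<Sum>m\<in>I. dzbar i (f m) z)"
    by (simp_all add: dz_def dzbar_def frechet_derivative_eqI sum.distrib sum_subtractf sum_distrib_left
        flip: sum_divide_distrib)
qed

lemma dz_cnj:
  assumes "f differentiable (at z)"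
  shows "dz i (\<lambda>x. cnj (f x)) z = cnj (dzbar i f z)" "dzbar i (\<lambda>x. cnj (f x)) z = cnj (dz i f z)"
proof -
  have "((\<lambda>x. cnj (f x)) has_derivative (\<lambda>v. cnj (frechet_derivative f (at z) v))) (at z)"
    using assms by (intro has_derivative_cnj) (simp add: frechet_derivative_works)
  then show "dz i (\<lambda>x. cnj (f x)) z = cnj (dzbar i f z)" "dzbar i (\<lambda>x. cnj (f x)) z = cnj (dz i f z)"
    by (simp_all add: dz_def dzbar_def frechet_derivative_eqI)
qed

lemma C_k_on_dz:
  assumes S: "open S" and f: "C_k_on (Suc k) f S"
  shows "C_k_on k (dz i f) S" "C_k_on k (dzbar i f) S"
proof -
  have "C_k_on k (\<lambda>x. frechet_derivative f (at x) (axis i 1) * (1 / 2)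
     + frechet_derivative f (at x) (axis i \<i>) * c) S" for c
    by (intro C_k_on_add[OF S] C_k_on_bounded_linear[OF bounded_linear_mult_left S] C_k_on_SucD(2)[OF f])
  from this[of "- \<i> / 2"] this[of "\<i> / 2"]
  show "C_k_on k (dz i f) S" "C_k_on k (dzbar i f) S"
    by (elim C_k_on_cong[OF S, rotated], simp add: dz_def dzbar_def field_simps)+
qed

lemma C_k_on_inverse:
  fixes f :: "'a::real_normed_vector \<Rightarrow> 'b::real_normed_field"
  assumes S: "open S" and nz: "\<And>x. x \<in> S \<Longrightarrow> f x \<noteq> 0"
  shows "C_k_on k f S \<Longrightarrow> C_k_on k (\<lambda>x. inverse (f x)) S"
proof (induction k)
  case 0
  then show ?case using nz by (simp add: continuous_on_inverse)
next
  case (Suc k)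
  note f = C_k_on_SucD[OF Suc.prems]
  show ?case
  proof (rule C_k_on_SucI[OF S])
    show "((\<lambda>x. inverse (f x)) has_derivative
      (\<lambda>v. - (inverse (f x) * frechet_derivative f (at x) v * inverse (f x)))) (at x)" if "x \<in> S" for x
      by (rule Deriv.has_derivative_inverse[OF nz[OF that] f(1)[OF that]])
    have I: "C_k_on k (\<lambda>x. inverse (f x)) S"
      by (rule Suc.IH[OF C_k_on_mono[OF Suc.prems]]) simp
    show "C_k_on k (\<lambda>x. - (inverse (f x) * frechet_derivative f (at x) v * inverse (f x))) S" for v
      by (intro C_k_on_bounded_linear[OF bounded_linear_minus[OF bounded_linear_ident] S]
          C_k_on_bilinear[OF bounded_bilinear_mult S] I f(2))
  qed
qed

lemma C_k_on_differentiable: "C_k_on k f S \<Longrightarrow> k > 0 \<Longrightarrow> z \<in> S \<Longrightarrow> f differentiable (at z)"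
  by (cases k) auto

text \<open>Iterated Wirtinger derivatives become combinations of iterated real directional
  derivatives, so that their commutation reduces to
  \<open>second_derivative_symmetric\<close>.\<close>

lemma frechet_derivative_dz:
  assumes f: "C_k_on 2 f S" and z: "z \<in> S"
  shows "frechet_derivative (dz i f) (at z) v =
      (frechet_derivative (\<lambda>y. frechet_derivative f (at y) (axis i 1)) (at z) v
        - \<i> * frechet_derivative (\<lambda>y. frechet_derivative f (at y) (axis i \<i>)) (at z) v) / 2"
    and "frechet_derivative (dzbar i f) (at z) v =
      (frechet_derivative (\<lambda>y. frechet_derivative f (at y) (axis i 1)) (at z) v
        + \<i> * frechet_derivative (\<lambda>y. frechet_derivative f (at y) (axis i \<i>)) (at z) v) / 2"
proof -
  have f': "C_k_on (Suc (Suc 0)) f S" using f by (simp add: numeral_2_eq_2)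
  note D = C_k_on_SucD(1)[OF C_k_on_SucD(2)[OF f'] z]
  have "((\<lambda>y. (frechet_derivative f (at y) (axis i 1) - \<i> * frechet_derivative f (at y) (axis i \<i>)) * (1/2))
     has_derivative (\<lambda>v. (frechet_derivative (\<lambda>y. frechet_derivative f (at y) (axis i 1)) (at z) v
        - \<i> * frechet_derivative (\<lambda>y. frechet_derivative f (at y) (axis i \<i>)) (at z) v) * (1/2))) (at z)"
    by (intro has_derivative_mult_left has_derivative_diff has_derivative_mult_right D)
  then have "(dz i f has_derivative (\<lambda>v. (frechet_derivative (\<lambda>y. frechet_derivative f (at y) (axis i 1)) (at z) v
        - \<i> * frechet_derivative (\<lambda>y. frechet_derivative f (at y) (axis i \<i>)) (at z) v) * (1/2))) (at z)"
    by (simp add: dz_def[abs_def])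
  then show "frechet_derivative (dz i f) (at z) v =
      (frechet_derivative (\<lambda>y. frechet_derivative f (at y) (axis i 1)) (at z) v
        - \<i> * frechet_derivative (\<lambda>y. frechet_derivative f (at y) (axis i \<i>)) (at z) v) / 2"
    by (simp add: frechet_derivative_eqI)
  have "((\<lambda>y. (frechet_derivative f (at y) (axis i 1) + \<i> * frechet_derivative f (at y) (axis i \<i>)) * (1/2))
     has_derivative (\<lambda>v. (frechet_derivative (\<lambda>y. frechet_derivative f (at y) (axis i 1)) (at z) v
        + \<i> * frechet_derivative (\<lambda>y. frechet_derivative f (at y) (axis i \<i>)) (at z) v) * (1/2))) (at z)"
    by (intro has_derivative_mult_left has_derivative_add has_derivative_mult_right D)
  then have "(dzbar i f has_derivative (\<lambda>v. (frechet_derivative (\<lambda>y. frechet_derivative f (at y) (axis i 1)) (at z) v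
        + \<i> * frechet_derivative (\<lambda>y. frechet_derivative f (at y) (axis i \<i>)) (at z) v) * (1/2))) (at z)"
    by (simp add: dzbar_def[abs_def])
  then show "frechet_derivative (dzbar i f) (at z) v =
      (frechet_derivative (\<lambda>y. frechet_derivative f (at y) (axis i 1)) (at z) v
        + \<i> * frechet_derivative (\<lambda>y. frechet_derivative f (at y) (axis i \<i>)) (at z) v) / 2"
    by (simp add: frechet_derivative_eqI)
qed

lemma dz_commute:
  assumes S: "open S" "z \<in> S" and f: "C_k_on 2 f S"
  shows "dz i (dz k f) z = dz k (dz i f) z"
    and "dzbar i (dzbar k f) z = dzbar k (dzbar i f) z"
    and "dzbar i (dz k f) z = dz k (dzbar i f) z"
proof -
  note s = second_derivative_symmetric[OF S f]
  note s' = s[of "axis k 1" "axis i 1"] s[of "axis k 1" "axis i \<i>"] s[of "axis k \<i>" "axis i 1"]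
    s[of "axis k \<i>" "axis i \<i>"]
  show "dz i (dz k f) z = dz k (dz i f) z"
    unfolding dz_def[of i "dz k f"] dz_def[of k "dz i f"] frechet_derivative_dz[OF f S(2)] s'
    by (simp add: field_simps)
  show "dzbar i (dzbar k f) z = dzbar k (dzbar i f) z"
    unfolding dzbar_def[of i "dzbar k f"] dzbar_def[of k "dzbar i f"] frechet_derivative_dz[OF f S(2)] s'
    by (simp add: field_simps)
  show "dzbar i (dz k f) z = dz k (dzbar i f) z"
    unfolding dzbar_def[of i "dz k f"] dz_def[of k "dzbar i f"] frechet_derivative_dz[OF f S(2)] s'
    by (simp add: field_simps)
qed

text \<open>Conjugation exchanges \<open>dz\<close> and \<open>dzbar\<close> and fixes a real
  function; commuting the two derivatives then shows that its complex Hessian is Hermitian.\<close>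

lemma cnj_dz_dzbar_real:
  assumes V: "open V" and x: "x \<in> V" and f: "C_k_on 2 f V" and real: "\<And>y. y \<in> V \<Longrightarrow> cnj (f y) = f y"
  shows "cnj (dz k (dzbar l f) x) = dz l (dzbar k f) x"
proof -
  have "C_k_on (Suc 1) f V" using f by (simp add: eval_nat_numeral)
  from C_k_on_dz(2)[OF V this] have d: "dzbar l f differentiable (at x)"
    using x by (auto intro: C_k_on_differentiable)
  have "cnj (dz k (dzbar l f) x) = dzbar k (\<lambda>y. cnj (dzbar l f y)) x"
    by (rule dz_cnj(2)[OF d, symmetric])
  also have "\<dots> = dzbar k (dz l f) x"
  proof (rule dz_cong(2)[OF V x])
    fix y assume y: "y \<in> V"
    have "cnj (dzbar l f y) = dz l (\<lambda>y. cnj (f y)) y"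
      by (rule dz_cnj(1)[symmetric], rule C_k_on_differentiable[OF f _ y]) simp
    also have "\<dots> = dz l f y" by (rule dz_cong(1)[OF V y real])
    finally show "cnj (dzbar l f y) = dz l f y" .
  qed
  also have "\<dots> = dz l (dzbar k f) x" by (rule dz_commute(3)[OF V x f])
  finally show ?thesis .
qed

section \<open>Differentiability of the inverse matrix\<close>

lemma differentiable_prod:
  fixes f :: "'i \<Rightarrow> 'a::real_normed_vector \<Rightarrow> 'b::real_normed_field"
  assumes "finite I" "\<And>i. i \<in> I \<Longrightarrow> f i differentiable (at z)"
  shows "(\<lambda>x. \<Prod>i\<in>I. f i x) differentiable (at z)"
  using assms by (induction I rule: finite_induct) (auto intro: differentiable_mult)

lemma differentiable_det:
  fixes H :: "'a::real_normed_vector \<Rightarrow> complex^'n::finite^'n"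
  assumes "\<And>a b. (\<lambda>x. H x $ a $ b) differentiable (at z)"
  shows "(\<lambda>x. det (H x)) differentiable (at z)"
  unfolding det_def
  by (intro differentiable_sum ballI differentiable_mult differentiable_const differentiable_prod assms)
     (simp_all add: finite_permutations)

lemma matrix_inv_mult:
  fixes A :: "complex^'n::finite^'n"
  assumes "invertible A"
  shows "A ** matrix_inv A = mat 1" "matrix_inv A ** A = mat 1"
  using someI_ex[OF assms[unfolded invertible_def]] by (simp_all add: matrix_inv_def)

text \<open>Cramer's rule for the equation whose right-hand side is the basis vector
  \<open>axis j 1\<close>: its solution is column \<open>j\<close> of the inverse.\<close>

lemma matrix_inv_component:
  fixes A :: "complex^'n::finite^'n"
  assumes "invertible A"
  shows "matrix_inv A $ m $ j = det (\<chi> a b. if b = m then axis j 1 $ a else A $ a $ b) / det A"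
proof -
  have "A *v (matrix_inv A *v axis j 1) = axis j 1"
    using assms by (simp add: matrix_vector_mul_assoc matrix_inv_mult)
  then have "matrix_inv A *v axis j 1 = (\<chi> k. det (\<chi> a b. if b = k then axis j 1 $ a else A $ a $ b) / det A)"
    using cramer[of A "matrix_inv A *v axis j 1" "axis j 1"] assms by (simp add: invertible_det_nz)
  moreover have "(matrix_inv A *v axis j 1) $ m = matrix_inv A $ m $ j"
    by (simp add: matrix_vector_mult_def axis_def if_distrib[of "\<lambda>x. _ * x"] cong: if_cong)
  ultimately show ?thesis by simp
qed

text \<open>Cramer's quotient of determinants agrees with the entry on all of \<open>V\<close>, and
  determinants are polynomial in the entries. No formula for the derivative is recorded, because
  \<open>curv_eq\<close> avoids it.\<close>

lemma differentiable_matrix_inv: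
  fixes G :: "'a::real_normed_vector \<Rightarrow> complex^'n::finite^'n"
  assumes V: "open V" "z \<in> V" and inv: "\<And>x. x \<in> V \<Longrightarrow> invertible (G x)"
    and G: "\<And>a b. (\<lambda>x. G x $ a $ b) differentiable (at z)"
  shows "(\<lambda>x. matrix_inv (G x) $ m $ j) differentiable (at z)"
proof -
  have "(\<lambda>x. (\<chi> a b. if b = m then axis j 1 $ a else G x $ a $ b) $ a $ b) differentiable (at z)" for a b
    by (cases "b = m") (simp_all add: G)
  then have "(\<lambda>x. det (\<chi> a b. if b = m then axis j 1 $ a else G x $ a $ b) / det (G x)) differentiable (at z)"
    using inv[OF V(2)] by (intro differentiable_divide differentiable_det G) (simp_all add: invertible_det_nz)
  then obtain D where "((\<lambda>x. det (\<chi> a b. if b = m then axis j 1 $ a else G x $ a $ b) / det (G x)) has_derivative D) (at z)"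
    by (auto simp: differentiable_def)
  then have "((\<lambda>x. matrix_inv (G x) $ m $ j) has_derivative D) (at z)"
    by (rule has_derivative_transform_within_open[OF _ V]) (simp only: matrix_inv_component[OF inv])
  then show ?thesis by (auto simp: differentiable_def)
qed

lemma matrix_inv_sum:
  fixes A :: "complex^'n::finite^'n"
  assumes "invertible A"
  shows "(\<Sum>k\<in>UNIV. matrix_inv A $ i $ k * A $ k $ j) = (if i = j then 1 else 0)"
    and "(\<Sum>k\<in>UNIV. A $ i $ k * matrix_inv A $ k $ j) = (if i = j then 1 else 0)"
  using arg_cong[OF matrix_inv_mult(2)[OF assms], of "\<lambda>B. B $ i $ j"]
    arg_cong[OF matrix_inv_mult(1)[OF assms], of "\<lambda>B. B $ i $ j"]
  by (simp_all add: matrix_matrix_mult_def mat_def)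

section \<open>The tensor Q of a metric with local potential\<close>

text \<open>The situation in one chart after the potential has descended. \<open>\<Psi>\<close> is
  complex valued but real, because \<open>dz\<close> and \<open>dzbar\<close> act on complex
  functions. Order 4 is two derivatives for the metric and two for its curvature.\<close>

locale local_lck_potential =
  fixes V :: "(complex^'n::finite) set" and \<Psi> :: "complex^'n \<Rightarrow> complex"
    and G :: "complex^'n \<Rightarrow> complex^'n^'n" and C :: complex
  assumes V: "open V" and \<Psi>: "C_k_on 4 \<Psi> V"
    and \<Psi>_real: "\<And>x. x \<in> V \<Longrightarrow> cnj (\<Psi> x) = \<Psi> x"
    and \<Psi>_nz: "\<And>x. x \<in> V \<Longrightarrow> \<Psi> x \<noteq> 0"
    and C: "C \<noteq> 0" "cnj C = C"
    and G_inv: "\<And>x. x \<in> V \<Longrightarrow> invertible (G x)"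
    and potential: "\<And>x k l. x \<in> V \<Longrightarrow> dz k (dzbar l \<Psi>) x = C * \<Psi> x * G x $ k $ l"
begin

abbreviation H :: "'n \<Rightarrow> 'n \<Rightarrow> complex^'n \<Rightarrow> complex" where
  "H k l \<equiv> dz k (dzbar l \<Psi>)"

lemma C_k_dzbar: "C_k_on 3 (dzbar l \<Psi>) V"
  by (rule C_k_on_dz[OF V]) (use \<Psi> in \<open>simp add: eval_nat_numeral\<close>)

lemma C_k_H: "C_k_on 2 (H k l) V"
  by (rule C_k_on_dz[OF V]) (use C_k_dzbar in \<open>simp add: eval_nat_numeral\<close>)

lemma C_k_dzbar2: "C_k_on 2 (dzbar l \<Psi>) V"
  by (rule C_k_on_mono[OF C_k_dzbar]) simp

lemma C_k_\<Psi>2: "C_k_on 2 \<Psi> V"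
  by (rule C_k_on_mono[OF \<Psi>]) simp

text \<open>Regularity of the metric is read off from the potential: \<open>G\<close> is the complex
  Hessian divided by \<open>C * \<Psi>\<close>, at the cost of two derivatives.\<close>

lemma C_k_G: "C_k_on 2 (\<lambda>x. G x $ k $ l) V"
proof -
  have "C_k_on 2 (\<lambda>x. inverse (C * \<Psi> x) * H k l x) V"
    by (intro C_k_on_bilinear[OF bounded_bilinear_mult V] C_k_on_inverse[OF V]
        C_k_on_bounded_linear[OF bounded_linear_mult_right V] C_k_H C_k_\<Psi>2) (simp add: C \<Psi>_nz)
  then show ?thesis
    by (rule C_k_on_cong[OF V, rotated]) (use C \<Psi>_nz in \<open>simp add: potential field_simps\<close>)
qed

lemma differentiable_G: "x \<in> V \<Longrightarrow> (\<lambda>x. G x $ k $ l) differentiable (at x)"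
  by (rule C_k_on_differentiable[OF C_k_G]) auto

lemma differentiable_dz_G:
  "x \<in> V \<Longrightarrow> dz i (\<lambda>x. G x $ k $ l) differentiable (at x)"
  "x \<in> V \<Longrightarrow> dzbar i (\<lambda>x. G x $ k $ l) differentiable (at x)"
proof -
  have "C_k_on (Suc 1) (\<lambda>x. G x $ k $ l) V" using C_k_G by (simp add: eval_nat_numeral)
  from C_k_on_dz[OF V this]
  show "x \<in> V \<Longrightarrow> dz i (\<lambda>x. G x $ k $ l) differentiable (at x)"
  "x \<in> V \<Longrightarrow> dzbar i (\<lambda>x. G x $ k $ l) differentiable (at x)"
    by (auto intro: C_k_on_differentiable)
qed

lemma differentiable_\<Psi>: "x \<in> V \<Longrightarrow> \<Psi> differentiable (at x)"
  by (rule C_k_on_differentiable[OF \<Psi>]) auto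

lemma differentiable_dz_\<Psi>: "x \<in> V \<Longrightarrow> dz i \<Psi> differentiable (at x)"
proof -
  have "C_k_on (Suc 1) \<Psi> V" using C_k_\<Psi>2 by (simp add: eval_nat_numeral)
  from C_k_on_dz(1)[OF V this]
  show "x \<in> V \<Longrightarrow> dz i \<Psi> differentiable (at x)" by (auto intro: C_k_on_differentiable)
qed

lemma dz_H_symmetric: "x \<in> V \<Longrightarrow> dz i (H k l) x = dz k (H i l) x"
  by (rule dz_commute(1)[OF V _ C_k_dzbar2])

lemma dzbar_H_symmetric:
  assumes x: "x \<in> V"
  shows "dzbar j (H k l) x = dzbar l (H k j) x"
proof -
  have "dzbar j (H k l) x = dz k (dzbar j (dzbar l \<Psi>)) x" for j l
    by (rule dz_commute(3)[OF V x C_k_dzbar2])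
  moreover have "dz k (dzbar j (dzbar l \<Psi>)) x = dz k (dzbar l (dzbar j \<Psi>)) x"
    by (rule dz_cong(1)[OF V x dz_commute(2)[OF V _ C_k_\<Psi>2]])
  ultimately show ?thesis by simp
qed

text \<open>The holomorphic pair and the antiholomorphic pair are exchanged separately. Each
  exchange takes place under a derivative of the other type, so the outer derivatives are commuted
  in between.\<close>

lemma dzbar_dz_H_symmetric:
  assumes x: "x \<in> V"
  shows "dzbar j (dz i (H k l)) x = dzbar l (dz k (H i j)) x"
proof -
  have "dzbar j (dz i (H k l)) x = dzbar j (dz k (H i l)) x"
    by (rule dz_cong(2)[OF V x dz_H_symmetric])
  also have "\<dots> = dz k (dzbar j (H i l)) x"
    by (rule dz_commute(3)[OF V x C_k_H])
  also have "\<dots> = dz k (dzbar l (H i j)) x"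
    by (rule dz_cong(1)[OF V x dzbar_H_symmetric])
  also have "\<dots> = dzbar l (dz k (H i j)) x"
    by (rule dz_commute(3)[OF V x C_k_H, symmetric])
  finally show ?thesis .
qed

lemma H_hermitian: "x \<in> V \<Longrightarrow> cnj (H k l x) = H l k x"
  by (rule cnj_dz_dzbar_real[OF V _ C_k_\<Psi>2 \<Psi>_real])

lemma G_hermitian: "x \<in> V \<Longrightarrow> cnj (G x $ k $ l) = G x $ l $ k"
  using H_hermitian[of x k l] C \<Psi>_nz[of x] by (simp add: potential \<Psi>_real)

lemma cnj_dz_G:
  assumes x: "x \<in> V"
  shows "cnj (dz i (\<lambda>x. G x $ k $ l) x) = dzbar i (\<lambda>x. G x $ l $ k) x"
  using dz_cnj(2)[OF differentiable_G[OF x]] dz_cong(2)[OF V x G_hermitian] by simp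

lemma dz_G:
  assumes x: "x \<in> V"
  shows "dz i (\<lambda>x. G x $ k $ l) x = dz i (H k l) x / (C * \<Psi> x) - dz i \<Psi> x / \<Psi> x * G x $ k $ l"
    and "dzbar i (\<lambda>x. G x $ k $ l) x = dzbar i (H k l) x / (C * \<Psi> x) - dzbar i \<Psi> x / \<Psi> x * G x $ k $ l"
proof -
  note d = differentiable_\<Psi>[OF x] differentiable_G[OF x]
  have eq: "H k l y = C * (\<Psi> y * G y $ k $ l)" if "y \<in> V" for y
    using potential[OF that] by simp
  show "dz i (\<lambda>x. G x $ k $ l) x = dz i (H k l) x / (C * \<Psi> x) - dz i \<Psi> x / \<Psi> x * G x $ k $ l"
    using dz_cong(1)[OF V x eq, where i = i] dz_cmult(1)[OF differentiable_mult[OF d]] dz_mult(1)[OF d] C \<Psi>_nz[OF x]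
    by (simp add: field_simps)
  show "dzbar i (\<lambda>x. G x $ k $ l) x = dzbar i (H k l) x / (C * \<Psi> x) - dzbar i \<Psi> x / \<Psi> x * G x $ k $ l"
    using dz_cong(2)[OF V x eq, where i = i] dz_cmult(2)[OF differentiable_mult[OF d]] dz_mult(2)[OF d] C \<Psi>_nz[OF x]
    by (simp add: field_simps)
qed

lemma dzbar_dz_H:
  assumes x: "x \<in> V"
  shows "dzbar j (dz i (H k l)) x = C * (\<Psi> x * dzbar j (dz i (\<lambda>x. G x $ k $ l)) x
    + dzbar j \<Psi> x * dz i (\<lambda>x. G x $ k $ l) x + dz i \<Psi> x * dzbar j (\<lambda>x. G x $ k $ l) x
    + H i j x * G x $ k $ l)"
proof -
  let ?g = "\<lambda>x. G x $ k $ l"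
  have eq: "H k l y = C * (\<Psi> y * G y $ k $ l)" if "y \<in> V" for y
    using potential[OF that] by simp
  have 1: "dz i (H k l) y = C * (\<Psi> y * dz i ?g y + dz i \<Psi> y * ?g y)" if y: "y \<in> V" for y
  proof -
    note d = differentiable_\<Psi>[OF y] differentiable_G[OF y]
    show ?thesis
      using dz_cong(1)[OF V y eq, where i = i] dz_cmult(1)[OF differentiable_mult[OF d]] dz_mult(1)[OF d] by simp
  qed
  note d = differentiable_\<Psi>[OF x] differentiable_dz_G(1)[OF x, of i k l]
    and d' = differentiable_dz_\<Psi>[OF x, of i] differentiable_G[OF x, of k l]
  note m = differentiable_mult[OF d] differentiable_mult[OF d']
  have "dzbar j (dz i (H k l)) x = dzbar j (\<lambda>y. C * (\<Psi> y * dz i ?g y + dz i \<Psi> y * ?g y)) x"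
    by (rule dz_cong(2)[OF V x 1])
  also have "\<dots> = C * (\<Psi> x * dzbar j (dz i ?g) x + dzbar j \<Psi> x * dz i ?g x
      + (dz i \<Psi> x * dzbar j ?g x + dzbar j (dz i \<Psi>) x * ?g x))"
    unfolding dz_cmult(2)[OF differentiable_add[OF m]] dz_add(2)[OF m] dz_mult(2)[OF d] dz_mult(2)[OF d'] ..
  also have "dzbar j (dz i \<Psi>) x = H i j x" by (rule dz_commute(3)[OF V x C_k_\<Psi>2])
  finally show ?thesis by (simp add: algebra_simps)
qed

section \<open>Connection, torsion and curvature through derivatives of the metric\<close>

lemma chern_Gamma_lower:
  assumes x: "x \<in> V"
  shows "(\<Sum>m\<in>UNIV. chern_Gamma G i k m x * G x $ m $ l) = dz i (\<lambda>x. G x $ k $ l) x"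
proof -
  have "(\<Sum>m\<in>UNIV. chern_Gamma G i k m x * G x $ m $ l)
      = (\<Sum>m\<in>UNIV. \<Sum>q\<in>UNIV. dz i (\<lambda>x. G x $ k $ q) x * (matrix_inv (G x) $ q $ m * G x $ m $ l))"
    unfolding chern_Gamma_def metric_inv_def sum_distrib_right by (intro sum.cong refl) (simp only: mult_ac)
  also have "\<dots> = (\<Sum>q\<in>UNIV. dz i (\<lambda>x. G x $ k $ q) x * (\<Sum>m\<in>UNIV. matrix_inv (G x) $ q $ m * G x $ m $ l))"
    by (subst sum.swap) (simp add: sum_distrib_left)
  also have "\<dots> = dz i (\<lambda>x. G x $ k $ l) x"
    by (simp add: matrix_inv_sum(1)[OF G_inv[OF x]] if_distrib[of "\<lambda>t. _ * t"] cong: if_cong)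
  finally show ?thesis .
qed

lemma torsion_eq:
  assumes x: "x \<in> V"
  shows "torsion G k p j x = dz k (\<lambda>x. G x $ p $ j) x - dz p (\<lambda>x. G x $ k $ j) x"
  unfolding chern_Gamma_lower[OF x, symmetric] torsion_def torsion_up_def
  by (simp add: algebra_simps sum_subtractf)

text \<open>Applying \<open>dzbar j\<close> to the identity \<open>chern_Gamma_lower\<close> gives,
  by the product rule, the lowered curvature with a minus sign and a connection term. This bypasses
  the derivative of the inverse metric.\<close>

lemma curv_eq:
  assumes x: "x \<in> V"
  shows "curv G i j k l x = (\<Sum>m\<in>UNIV. chern_Gamma G i k m x * dzbar j (\<lambda>x. G x $ m $ l) x)
    - dzbar j (dz i (\<lambda>x. G x $ k $ l)) x"
proof -
  have "(\<lambda>x. metric_inv G x m q) differentiable (at x)" for m q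
    unfolding metric_inv_def by (rule differentiable_matrix_inv[OF V x G_inv differentiable_G[OF x]])
  then have dG: "chern_Gamma G i k m differentiable (at x)" for m
    unfolding chern_Gamma_def[abs_def]
    by (intro differentiable_sum ballI differentiable_mult differentiable_dz_G(1)[OF x] finite)
  note dm = differentiable_mult[OF dG differentiable_G[OF x]]
  have "dzbar j (dz i (\<lambda>x. G x $ k $ l)) x = dzbar j (\<lambda>y. \<Sum>m\<in>UNIV. chern_Gamma G i k m y * G y $ m $ l) x"
    by (rule dz_cong(2)[OF V x chern_Gamma_lower[symmetric]])
  also have "\<dots> = (\<Sum>m\<in>UNIV. chern_Gamma G i k m x * dzbar j (\<lambda>x. G x $ m $ l) x)
      + (\<Sum>m\<in>UNIV. dzbar j (chern_Gamma G i k m) x * G x $ m $ l)"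
    by (simp only: dz_sum(2)[OF dm] dz_mult(2)[OF dG differentiable_G[OF x]] sum.distrib)
  finally show ?thesis
    by (simp add: curv_def curv_up_def sum_negf mult.commute)
qed

text \<open>Contraction by the inverse metric: \<open>f\<close> carries the antiholomorphic index
  and \<open>h\<close> the holomorphic one. Both quadratic terms of Q have this shape, so one
  bilinear calculus handles them.\<close>

definition contr :: "complex^'n \<Rightarrow> ('n \<Rightarrow> complex) \<Rightarrow> ('n \<Rightarrow> complex) \<Rightarrow> complex" where
  "contr x f h = (\<Sum>p\<in>UNIV. \<Sum>q\<in>UNIV. metric_inv G x p q * f q * h p)"

lemma contr_linear:
  "contr x (\<lambda>q. f q - c * f' q) h = contr x f h - c * contr x f' h"
  "contr x f (\<lambda>p. h p - c * h' p) = contr x f h - c * contr x f h'"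
  by (simp_all add: contr_def algebra_simps sum_subtractf sum_distrib_left)

lemma contr_G:
  assumes x: "x \<in> V"
  shows "contr x (\<lambda>q. G x $ i $ q) h = h i" "contr x f (\<lambda>p. G x $ p $ j) = f j"
proof -
  have "contr x (\<lambda>q. G x $ i $ q) h = (\<Sum>p\<in>UNIV. (\<Sum>q\<in>UNIV. G x $ i $ q * matrix_inv (G x) $ q $ p) * h p)"
    unfolding contr_def metric_inv_def sum_distrib_right by (intro sum.cong refl) (simp only: mult_ac)
  then show "contr x (\<lambda>q. G x $ i $ q) h = h i"
    by (simp add: matrix_inv_sum(2)[OF G_inv[OF x]] if_distrib[of "\<lambda>t. t * _"] cong: if_cong)
  have "contr x f (\<lambda>p. G x $ p $ j) = (\<Sum>q\<in>UNIV. f q * (\<Sum>p\<in>UNIV. matrix_inv (G x) $ q $ p * G x $ p $ j))"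
    unfolding contr_def metric_inv_def sum_distrib_left
    by (subst sum.swap) (intro sum.cong refl, simp only: mult_ac)
  then show "contr x f (\<lambda>p. G x $ p $ j) = f j"
    by (simp add: matrix_inv_sum(1)[OF G_inv[OF x]] if_distrib[of "\<lambda>t. _ * t"] cong: if_cong)
qed

text \<open>The metric is Hermitian, so conjugating the second torsion factor turns its
  \<open>dz\<close> into \<open>dzbar\<close> and transposes the metric indices. Q is then expressed
  by derivatives of \<open>G\<close> alone.\<close>

lemma Q_tensor_contr:
  assumes x: "x \<in> V"
  shows "Q_tensor G i j k l x =
    contr x (\<lambda>q. dz i (\<lambda>x. G x $ k $ q) x) (\<lambda>p. dzbar j (\<lambda>x. G x $ p $ l) x)
    - dzbar j (dz i (\<lambda>x. G x $ k $ l)) x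
    - contr x (\<lambda>q. dzbar l (\<lambda>x. G x $ i $ q) x - dzbar q (\<lambda>x. G x $ i $ l) x)
        (\<lambda>p. dz k (\<lambda>x. G x $ p $ j) x - dz p (\<lambda>x. G x $ k $ j) x)"
proof -
  have swap: "u * v * w = u * w * v" for u v w :: complex by simp
  have "(\<Sum>m\<in>UNIV. chern_Gamma G i k m x * dzbar j (\<lambda>x. G x $ m $ l) x)
      = contr x (\<lambda>q. dz i (\<lambda>x. G x $ k $ q) x) (\<lambda>p. dzbar j (\<lambda>x. G x $ p $ l) x)"
    by (simp only: contr_def chern_Gamma_def sum_distrib_right)
  moreover have "(\<Sum>p\<in>UNIV. \<Sum>q\<in>UNIV. metric_inv G x p q * torsion G k p j x * cnj (torsion G l q i x))
      = contr x (\<lambda>q. dzbar l (\<lambda>x. G x $ i $ q) x - dzbar q (\<lambda>x. G x $ i $ l) x)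
        (\<lambda>p. dz k (\<lambda>x. G x $ p $ j) x - dz p (\<lambda>x. G x $ k $ j) x)"
    unfolding contr_def torsion_eq[OF x] complex_cnj_diff cnj_dz_G[OF x]
    by (intro sum.cong refl swap)
  ultimately show ?thesis by (simp only: Q_tensor_def curv_eq[OF x])
qed

text \<open>Put \<open>a = \<partial> log \<Psi>\<close> and \<open>b = cnj a\<close>, and let \<open>S\<close>, \<open>S'\<close>, \<open>S4\<close> be the third and fourth
  derivatives of \<open>\<Psi>\<close> divided by \<open>C \<Psi>\<close>, which inherit the symmetries of mixed derivatives. The
  non-symmetric part \<open>- a\<^sub>i b\<^sub>j g\<^sub>k\<^sub>l\<close> of the curvature is completed to a symmetric expression
  by the terms of the torsion product.\<close>

lemma Q_tensor_symmetric:
  assumes x: "x \<in> V"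
  shows "Q_tensor G i j k l x = Q_tensor G k l i j x"
proof -
  define a where "a i = dz i \<Psi> x / \<Psi> x" for i
  define b where "b i = dzbar i \<Psi> x / \<Psi> x" for i
  define S where "S i k l = dz i (H k l) x / (C * \<Psi> x)" for i k l
  define S' where "S' j k l = dzbar j (H k l) x / (C * \<Psi> x)" for j k l
  define S4 where "S4 i j k l = dzbar j (dz i (H k l)) x / (C * \<Psi> x)" for i j k l
  let ?g = "\<lambda>k l. G x $ k $ l"
  have d: "dz i (\<lambda>x. G x $ k $ l) x = S i k l - a i * ?g k l" for i k l
    by (simp add: dz_G[OF x] a_def S_def)
  have d': "dzbar i (\<lambda>x. G x $ k $ l) x = S' i k l - b i * ?g k l" for i k l
    by (simp add: dz_G[OF x] b_def S'_def)
  have S: "S i k l = S k i l" for i k l by (simp add: S_def dz_H_symmetric[OF x])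
  have S': "S' j k l = S' l k j" for j k l by (simp add: S'_def dzbar_H_symmetric[OF x])
  have S4: "S4 i j k l = S4 k l i j" for i j k l by (simp add: S4_def dzbar_dz_H_symmetric[OF x])
  \<comment> \<open>The factor 2 arises because the product rule has two mixed terms, and each
    contributes \<open>a i * b j\<close> times the metric when \<open>d\<close> and
    \<open>d'\<close> are inserted. The last term comes from the Hessian \<open>H i j\<close>,
    replaced through \<open>potential\<close>.\<close>
  have dd: "dzbar j (dz i (\<lambda>x. G x $ k $ l)) x = S4 i j k l - a i * S' j k l - b j * S i k l
      + 2 * a i * b j * ?g k l - C * ?g i j * ?g k l" for i j k l
  proof -
    have "S4 i j k l = dzbar j (dz i (\<lambda>x. G x $ k $ l)) x
      + b j * dz i (\<lambda>x. G x $ k $ l) x + a i * dzbar j (\<lambda>x. G x $ k $ l) x + C * ?g i j * ?g k l"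
      using C \<Psi>_nz[OF x] unfolding S4_def dzbar_dz_H[OF x] potential[OF x] a_def b_def
      by (simp add: field_simps)
    then show ?thesis unfolding d d' by (simp add: algebra_simps)
  qed
  have AA: "contr x (\<lambda>q. dz i (\<lambda>x. G x $ k $ q) x) (\<lambda>p. dzbar j (\<lambda>x. G x $ p $ l) x)
    = contr x (S i k) (\<lambda>p. S' j p l) - b j * S i k l - a i * S' j k l + a i * b j * ?g k l" for i j k l
    unfolding d d' contr_linear contr_G[OF x] by (simp add: algebra_simps)
  have TT: "contr x (\<lambda>q. dzbar l (\<lambda>x. G x $ i $ q) x - dzbar q (\<lambda>x. G x $ i $ l) x)
        (\<lambda>p. dz k (\<lambda>x. G x $ p $ j) x - dz p (\<lambda>x. G x $ k $ j) x)
    = ?g i l * ?g k j * contr x b a - a k * b j * ?g i l - a i * b l * ?g k j + a k * b l * ?g i j" for i j k l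
  proof -
    \<comment> \<open>The symmetry \<open>S'\<close> eliminates the third derivatives of the
      potential. Writing the remainder as zero minus a multiple gives it the form that
      \<open>contr_linear\<close> can split.\<close>
    have "(\<lambda>q. dzbar l (\<lambda>x. G x $ i $ q) x - dzbar q (\<lambda>x. G x $ i $ l) x)
       = (\<lambda>q. (0 - (- ?g i l) * b q) - b l * ?g i q)"
      unfolding d' using S'[of l i] by (simp add: fun_eq_iff algebra_simps)
    moreover have "(\<lambda>p. dz k (\<lambda>x. G x $ p $ j) x - dz p (\<lambda>x. G x $ k $ j) x)
       = (\<lambda>p. (0 - (- ?g k j) * a p) - a k * ?g p j)"
      unfolding d using S[of k _ j] by (simp add: fun_eq_iff algebra_simps)
    moreover have "contr x (\<lambda>q. 0) h = 0" "contr x f (\<lambda>p. 0) = 0" for f h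
      by (simp_all add: contr_def)
    ultimately show ?thesis
      by (simp only: contr_linear contr_G[OF x]) (simp add: algebra_simps)
  qed
  have "contr x (S i k) (\<lambda>p. S' j p l) = contr x (S k i) (\<lambda>p. S' l p j)"
  proof -
    have "S i k = S k i" by (rule ext) (rule S)
    moreover have "(\<lambda>p. S' j p l) = (\<lambda>p. S' l p j)" by (rule ext) (rule S')
    ultimately show ?thesis by simp
  qed
  \<comment> \<open>The terms with a single \<open>S\<close> or \<open>S'\<close> cancel between
    \<open>AA\<close> and \<open>dd\<close>, and the coefficients 1 and 2 of
    \<open>a i * b j * ?g k l\<close> combine to -1.\<close>
  then show ?thesis
    unfolding Q_tensor_contr[OF x] AA TT dd using S4[of i j k l] by (simp add: algebra_simps)
qed

end

section \<open>Holomorphic changes of coordinates\<close>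

text \<open>The splitting of the real differential into its (1,0) and (0,1) parts, obtained by
  writing \<open>w\<close> in the real basis of vectors \<open>axis a 1\<close> and
  \<open>axis a \<i>\<close>.\<close>

lemma frechet_derivative_dz_expand:
  assumes "f differentiable (at z)"
  shows "frechet_derivative f (at z) w = (\<Sum>a\<in>UNIV. dz a f z * w $ a + dzbar a f z * cnj (w $ a))"
proof -
  let ?D = "frechet_derivative f (at z)"
  have lin: "linear ?D" using assms by (rule linear_frechet_derivative)
  have "w = (\<Sum>a\<in>UNIV. Re (w $ a) *\<^sub>R axis a 1 + Im (w $ a) *\<^sub>R axis a \<i>)"
  proof -
    have "w = (\<Sum>a\<in>UNIV. w $ a *s axis a 1)" by (simp add: basis_expansion)
    also have "\<dots> = (\<Sum>a\<in>UNIV. Re (w $ a) *\<^sub>R axis a 1 + Im (w $ a) *\<^sub>R axis a \<i>)"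
      by (intro sum.cong refl) (simp add: vec_eq_iff axis_def complex_eq_iff)
    finally show ?thesis .
  qed
  then have "?D w = ?D (\<Sum>a\<in>UNIV. Re (w $ a) *\<^sub>R axis a 1 + Im (w $ a) *\<^sub>R axis a \<i>)" by simp
  also have "\<dots> = (\<Sum>a\<in>UNIV. Re (w $ a) *\<^sub>R ?D (axis a 1) + Im (w $ a) *\<^sub>R ?D (axis a \<i>))"
    by (simp only: linear_sum[OF lin] linear_add[OF lin] linear_cmul[OF lin])
  also have "\<dots> = (\<Sum>a\<in>UNIV. dz a f z * w $ a + dzbar a f z * cnj (w $ a))"
    by (intro sum.cong refl) (simp add: dz_def dzbar_def complex_eq_iff field_simps)
  finally show ?thesis .
qed

lemma axis_i: "axis i \<i> = \<i> *s axis i 1"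
  by (simp add: vec_eq_iff axis_def)

text \<open>The derivative of \<open>E\<close> is complex linear, so passing from
  \<open>axis i 1\<close> to \<open>axis i \<i>\<close> multiplies the (1,0) part by
  \<open>\<i>\<close> and the (0,1) part by \<open>- \<i>\<close>. The Wirtinger combinations
  therefore isolate one part each.\<close>

lemma dz_compose_hol:
  assumes E: "hol_map_on E V" and x: "x \<in> V" and f: "f differentiable (at (E x))"
  shows "dz i (\<lambda>x. f (E x)) x = (\<Sum>a\<in>UNIV. dz a f (E x) * frechet_derivative E (at x) (axis i 1) $ a)"
    and "dzbar i (\<lambda>x. f (E x)) x
      = (\<Sum>a\<in>UNIV. dzbar a f (E x) * cnj (frechet_derivative E (at x) (axis i 1) $ a))"
proof -
  let ?e = "frechet_derivative E (at x) (axis i 1)"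
  have fd: "frechet_derivative (\<lambda>x. f (E x)) (at x) v
      = frechet_derivative f (at (E x)) (frechet_derivative E (at x) v)" for v
    using has_derivative_compose[OF hol_map_onD(1)[OF E x] f[unfolded frechet_derivative_works]]
    by (simp add: frechet_derivative_eqI)
  have 1: "frechet_derivative (\<lambda>x. f (E x)) (at x) (axis i 1)
      = (\<Sum>a\<in>UNIV. dz a f (E x) * ?e $ a) + (\<Sum>a\<in>UNIV. dzbar a f (E x) * cnj (?e $ a))"
    unfolding fd frechet_derivative_dz_expand[OF f] by (simp add: sum.distrib)
  have 2: "frechet_derivative (\<lambda>x. f (E x)) (at x) (axis i \<i>)
      = \<i> * (\<Sum>a\<in>UNIV. dz a f (E x) * ?e $ a) - \<i> * (\<Sum>a\<in>UNIV. dzbar a f (E x) * cnj (?e $ a))"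
    unfolding fd frechet_derivative_dz_expand[OF f] axis_i hol_map_onD(2)[OF E x]
    by (simp add: sum.distrib sum_subtractf sum_distrib_left mult_ac)
  show "dz i (\<lambda>x. f (E x)) x = (\<Sum>a\<in>UNIV. dz a f (E x) * ?e $ a)"
    and "dzbar i (\<lambda>x. f (E x)) x = (\<Sum>a\<in>UNIV. dzbar a f (E x) * cnj (?e $ a))"
    unfolding dz_def[of i] dzbar_def[of i] 1 2 by (simp_all add: field_simps)
qed

lemma dzbar_hol:
  assumes u: "hol_fun_on u V" and x: "x \<in> V"
  shows "dzbar i u x = 0"
  unfolding dzbar_def axis_i hol_fun_onD(2)[OF u x] by simp

text \<open>The coefficients from the first chain rule are conjugates of the holomorphic functions
  \<open>h b\<close>, hence annihilated by \<open>dz\<close>. No second derivative of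
  \<open>E\<close> survives, and the complex Hessian transforms like a sesquilinear form.\<close>

lemma dz_dzbar_compose_hol:
  assumes V: "open V" and W: "open W" and E: "hol_map_on E V" "E ` V \<subseteq> W" and f: "C_k_on 2 f W"
    and x: "x \<in> V"
  defines "e i \<equiv> frechet_derivative E (at x) (axis i 1)"
  shows "dz i (dzbar j (\<lambda>x. f (E x))) x
    = (\<Sum>a\<in>UNIV. \<Sum>b\<in>UNIV. dz a (dzbar b f) (E x) * (e i $ a * cnj (e j $ b)))"
proof -
  define h where "h b y = frechet_derivative E (at y) (axis j 1) $ b" for b y
  have EW: "E y \<in> W" if "y \<in> V" for y using E(2) that by blast
  have df: "f differentiable (at (E y))" if "y \<in> V" for y
    by (rule C_k_on_differentiable[OF f _ EW[OF that]]) simp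
  have "C_k_on (Suc 1) f W" using f by (simp add: eval_nat_numeral)
  from C_k_on_dz(2)[OF W this] have ddf: "dzbar b f differentiable (at (E x))" for b
    using EW[OF x] by (auto intro: C_k_on_differentiable)
  have hh: "hol_fun_on (h b) V" for b
  proof -
    have "hol_fun_on (\<lambda>y. frechet_derivative (\<lambda>y. E y $ b) (at y) (axis j 1)) V"
      by (rule hol_fun_on_frechet_derivative[OF hol_map_on_component[OF E(1)] V])
    moreover have "frechet_derivative (\<lambda>y. E y $ b) (at y) (axis j 1) = h b y" if "y \<in> V" for y
      unfolding h_def
      by (rule fun_cong[OF frechet_derivative_eqI])
         (rule bounded_linear.has_derivative[OF bounded_linear_vec_nth hol_map_onD(1)[OF E(1) that]])
    ultimately show ?thesis unfolding hol_fun_on_def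
      by (meson V has_derivative_transform_within_open)
  qed
  have dh: "h b differentiable (at x)" for b
    using hol_fun_onD(1)[OF hh x] by (auto simp: differentiable_def)
  have dch: "(\<lambda>y. cnj (h b y)) differentiable (at x)" for b
    using has_derivative_cnj[OF hol_fun_onD(1)[OF hh x]] by (auto simp: differentiable_def)
  have dE: "(\<lambda>y. dzbar b f (E y)) differentiable (at x)" for b
    using has_derivative_compose[OF hol_map_onD(1)[OF E(1) x] ddf[unfolded frechet_derivative_works]]
    by (auto simp: differentiable_def)
  have "dz i (dzbar j (\<lambda>x. f (E x))) x = dz i (\<lambda>y. \<Sum>b\<in>UNIV. dzbar b f (E y) * cnj (h b y)) x"
    unfolding h_def by (rule dz_cong(1)[OF V x dz_compose_hol(2)[OF E(1) _ df]])
  also have "\<dots> = (\<Sum>b\<in>UNIV. dzbar b f (E x) * cnj (dzbar i (h b) x)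
      + (\<Sum>a\<in>UNIV. dz a (dzbar b f) (E x) * e i $ a) * cnj (h b x))"
    unfolding dz_sum(1)[OF differentiable_mult[OF dE dch]] dz_mult(1)[OF dE dch] dz_cnj(1)[OF dh]
      dz_compose_hol(1)[OF E(1) x ddf] e_def ..
  also have "\<dots> = (\<Sum>b\<in>UNIV. \<Sum>a\<in>UNIV. dz a (dzbar b f) (E x) * (e i $ a * cnj (e j $ b)))"
    unfolding dzbar_hol[OF hh x] by (simp add: e_def h_def sum_distrib_right mult.assoc)
  finally show ?thesis by (subst sum.swap)
qed

text \<open>Openness of the image comes from invariance of domain. The inverse of a complex linear
  derivative is complex linear, so the inverse map is holomorphic in the same pointwise
  sense.\<close>

lemma hol_map_on_inverse:
  fixes F :: "complex^'n::finite \<Rightarrow> complex^'n"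
  assumes W: "open W" and F: "hol_map_on F W" and inj: "inj_on F W"
    and inj': "\<forall>w\<in>W. inj (frechet_derivative F (at w))"
  shows "open (F ` W)" "hol_map_on (the_inv_into W F) (F ` W)"
    and "w \<in> W \<Longrightarrow>
      frechet_derivative F (at w) (frechet_derivative (the_inv_into W F) (at (F w)) v) = v"
proof -
  have cont: "continuous_on W F"
    by (auto intro!: continuous_at_imp_continuous_on has_derivative_continuous hol_map_onD(1)[OF F])
  show "open (F ` W)" by (rule invariance_of_domain[OF cont W inj])
  have inv: "\<exists>D. (the_inv_into W F has_derivative D) (at (F w)) \<and> (\<forall>a v. D (a *s v) = a *s D v)
      \<and> (\<forall>v. frechet_derivative F (at w) (D v) = v)" if w: "w \<in> W" for w
  proof -
    note dF = hol_map_onD[OF F w]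
    have lin: "linear (frechet_derivative F (at w))" using dF(1) by (rule has_derivative_linear)
    obtain D where D: "linear D" "\<And>v. D (frechet_derivative F (at w) v) = v"
        "\<And>v. frechet_derivative F (at w) (D v) = v"
      using linear_injective_isomorphism[OF lin] inj' w by blast
    have "(the_inv_into W F has_derivative D) (at (F w))"
      by (rule has_derivative_inverse_strong[OF W w cont the_inv_into_f_f[OF inj] dF(1)])
         (simp_all add: D fun_eq_iff)
    moreover have "D (a *s v) = a *s D v" for a v
      using D(2)[of "a *s D v"] by (simp only: dF(2) D(3))
    ultimately show ?thesis using D(3) by blast
  qed
  then show "hol_map_on (the_inv_into W F) (F ` W)" unfolding hol_map_on_def by blast
  show "frechet_derivative F (at w) (frechet_derivative (the_inv_into W F) (at (F w)) v) = v" if "w \<in> W"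
    using inv[OF that] by (auto dest: frechet_derivative_eqI)
qed

section \<open>Hermitian forms and their components\<close>

locale hermitian_form =
  fixes h :: "complex^'n::finite \<Rightarrow> complex^'n \<Rightarrow> real"
  assumes bil: "bilinear h" and J_invariant: "h (cx_J u) (cx_J v) = h u v"
    and pos: "u \<noteq> 0 \<Longrightarrow> h u u > 0"
begin

lemma J_left: "h (cx_J u) v = - h u (cx_J v)"
proof -
  have "h (cx_J u) v = h (cx_J (cx_J u)) (cx_J v)" by (simp only: J_invariant)
  also have "cx_J (cx_J u) = - u" by (simp add: vec_eq_iff)
  finally show ?thesis using bilinear_lneg[OF bil] by simp
qed

text \<open>The complex form with real part \<open>h\<close>, complex linear in the first argument
  and conjugate linear in the second.\<close>

definition sesq where "sesq u v = Complex (h u v) (h u (cx_J v))"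

lemma sesq_add_left: "sesq (u + u') v = sesq u v + sesq u' v"
  and sesq_add_right: "sesq u (v + v') = sesq u v + sesq u v'"
  using bil by (simp_all add: sesq_def complex_eq_iff bilinear_ladd bilinear_radd vector_add_ldistrib)

lemma sesq_scale_left: "sesq (a *s u) v = a * sesq u v"
proof -
  have a: "a *s u = Re a *\<^sub>R u + Im a *\<^sub>R cx_J u"
    by (simp add: vec_eq_iff complex_eq_iff)
  have J: "h (cx_J u) (cx_J v) = h u v" "h (cx_J u) v = - h u (cx_J v)"
    by (rule J_invariant, rule J_left)
  show ?thesis
    unfolding a sesq_def complex_eq_iff using bil
    by (simp add: bilinear_ladd bilinear_lmul J)
qed

lemma sesq_scale_right: "sesq u (a *s v) = cnj a * sesq u v"
proof -
  have a: "a *s v = Re a *\<^sub>R v + Im a *\<^sub>R cx_J v" "cx_J (a *s v) = Re a *\<^sub>R cx_J v - Im a *\<^sub>R v"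
    by (simp_all add: vec_eq_iff complex_eq_iff)
  show ?thesis
    unfolding sesq_def a(2) unfolding a(1) complex_eq_iff using bil
    by (simp add: bilinear_radd bilinear_rsub bilinear_rmul)
qed

lemma sesq_sum_left: "sesq (\<Sum>i\<in>I. f i) v = (\<Sum>i\<in>I. sesq (f i) v)"
proof (induction I rule: infinite_finite_induct)
  have "sesq 0 v = 0" using sesq_scale_left[of 0 0 v] by simp
  then show "sesq (sum f {}) v = (\<Sum>i\<in>{}. sesq (f i) v)"
    and "\<And>A. infinite A \<Longrightarrow> sesq (sum f A) v = (\<Sum>i\<in>A. sesq (f i) v)" by simp_all
qed (simp add: sesq_add_left)

lemma sesq_sum_right: "sesq u (\<Sum>i\<in>I. f i) = (\<Sum>i\<in>I. sesq u (f i))"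
proof (induction I rule: infinite_finite_induct)
  have "sesq u 0 = 0" using sesq_scale_right[of u 0 0] by simp
  then show "sesq u (sum f {}) = (\<Sum>i\<in>{}. sesq u (f i))"
    and "\<And>A. infinite A \<Longrightarrow> sesq u (sum f A) = (\<Sum>i\<in>A. sesq u (f i))" by simp_all
qed (simp add: sesq_add_right)

lemma sesq_expand: "sesq u v = (\<Sum>i\<in>UNIV. u $ i * (\<Sum>j\<in>UNIV. sesq (axis i 1) (axis j 1) * cnj (v $ j)))"
proof -
  have "sesq u v = sesq (\<Sum>i\<in>UNIV. u $ i *s axis i 1) v"
    by (simp only: basis_expansion)
  also have "\<dots> = (\<Sum>i\<in>UNIV. u $ i * sesq (axis i 1) v)"
    by (simp only: sesq_sum_left sesq_scale_left)
  moreover have "sesq (axis i 1) v = (\<Sum>j\<in>UNIV. sesq (axis i 1) (axis j 1) * cnj (v $ j))" for i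
    using sesq_sum_right[of "axis i 1" "\<lambda>j. v $ j *s axis j 1" UNIV]
    by (simp only: basis_expansion sesq_scale_right mult.commute[of "cnj _"])
  ultimately show ?thesis by simp
qed

text \<open>A kernel vector \<open>w\<close>, conjugated because the second slot of
  \<open>sesq\<close> is conjugate linear, yields \<open>u\<close> with \<open>sesq u u = 0\<close>.
  Its real part is \<open>h u u\<close>, so positivity gives \<open>u = 0\<close>.\<close>

lemma invertible_gram: "invertible (\<chi> i j. sesq (axis i 1) (axis j 1) / 2)"
proof -
  let ?G = "\<chi> i j. sesq (axis i 1) (axis j 1) / 2"
  have "w = 0" if "?G *v w = 0" for w
  proof -
    define u where "u = (\<chi> i. cnj (w $ i))"
    have "(\<Sum>j\<in>UNIV. sesq (axis i 1) (axis j 1) * w $ j) = 0" for i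
      using arg_cong[OF that, of "\<lambda>v. v $ i"]
      by (simp add: matrix_vector_mult_def flip: sum_divide_distrib)
    then have "sesq u u = 0" by (subst sesq_expand) (simp add: u_def)
    then have "h u u = 0" by (simp add: sesq_def complex_eq_iff)
    then have "u = 0" using pos[of u] by auto
    then show "w = 0" by (simp add: u_def vec_eq_iff)
  qed
  then show ?thesis
    by (simp add: invertible_left_inverse matrix_left_invertible_ker)
qed

end

text \<open>By invariance under J the two summands in each part coincide, which turns the factor 1/4
  into 1/2.\<close>

lemma metric_comp_hermitian:
  assumes "hermitian_form (h z)"
  shows "metric_comp h z = (\<chi> i j. hermitian_form.sesq (h z) (axis i 1) (axis j 1) / 2)"
proof -
  interpret hermitian_form "h z" by fact
  show ?thesis
    unfolding metric_comp_def sesq_def J_invariant J_left by (simp add: vec_eq_iff complex_eq_iff bilinear_rneg[OF bil])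
qed

section \<open>LCK manifolds with potential\<close>

lemma chart_inv:
  assumes "is_chart c"
  shows "z \<in> chart_img c \<Longrightarrow> chart_inv c z \<in> fst c"
    and "z \<in> chart_img c \<Longrightarrow> snd c (chart_inv c z) = z"
    and "x \<in> fst c \<Longrightarrow> chart_inv c (snd c x) = x"
    and "inj_on (snd c) (fst c)" "continuous_on (chart_img c) (chart_inv c)"
  using assms unfolding is_chart_def homeomorphism_def
  by (auto simp: image_iff inj_on_def intro: sym) (metis+)

text \<open>The Kaehler form is positive on \<open>u\<close> and \<open>cx_J u\<close> for nonzero
  \<open>u\<close>, whereas the right-hand side of \<open>pot\<close> would vanish if
  \<open>C = 0\<close> or if the derivative killed \<open>u\<close>.\<close>

lemma frechet_derivative_loc_map_kernel:
  fixes g :: "('m, 'n::finite) two_tensor"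
  assumes bil: "bilinear (g d (loc_map p c d w))"
    and kahler: "kahler_form B (i_ddbar \<phi>)" and c: "c \<in> B" "w \<in> chart_img c"
    and pot: "\<And>u v. inverse (\<phi> (chart_inv c w)) * i_ddbar \<phi> c w u v
             = C * assoc_form g d (loc_map p c d w)
                 (frechet_derivative (loc_map p c d) (at w) u)
                 (frechet_derivative (loc_map p c d) (at w) v)"
    and pos: "\<phi> (chart_inv c w) > 0"
  shows "C \<noteq> 0"
    and "frechet_derivative (loc_map p c d) (at w) u = 0 \<Longrightarrow> u = 0"
proof -
  have K: "i_ddbar \<phi> c w u (cx_J u) > 0" if "u \<noteq> 0" for u
    using kahler c that unfolding kahler_form_def by blast
  \<comment> \<open>Any nonzero tangent vector serves as a test; \<open>undefined\<close> names some
    index of the inhabited type \<open>'n\<close>.\<close>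
  have "(axis undefined 1 :: complex^'n) \<noteq> 0" by (simp add: axis_eq_0_iff)
  from K[OF this] pot[of "axis undefined 1" "cx_J (axis undefined 1)"] pos show "C \<noteq> 0" by auto
  assume 0: "frechet_derivative (loc_map p c d) (at w) u = 0"
  have "assoc_form g d (loc_map p c d w) 0 v = 0" for v
    using bilinear_lzero[OF bil] by (simp add: assoc_form_def vec.scale_zero_right)
  with pot[of u "cx_J u"] 0 pos have "i_ddbar \<phi> c w u (cx_J u) = 0" by simp
  with K[of u] show "u = 0" by auto
qed

text \<open>Transport through the inverse \<open>E\<close> of \<open>F\<close> turns the identity on
  \<open>W\<close> into one for the function \<open>f\<close> composed with \<open>E\<close> on the
  image. Testing it on suitable real vectors recovers the complex components demanded by
  \<open>local_lck_potential\<close>.\<close>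

lemma Q_tensor_symmetric_pullback:
  fixes F :: "complex^'n::finite \<Rightarrow> complex^'n" and f :: "complex^'n \<Rightarrow> real"
    and h :: "complex^'n \<Rightarrow> complex^'n \<Rightarrow> complex^'n \<Rightarrow> real"
  assumes W: "open W" and F: "hol_map_on F W" "inj_on F W"
    and ker: "\<And>w u. w \<in> W \<Longrightarrow> frechet_derivative F (at w) u = 0 \<Longrightarrow> u = 0"
    and f: "C_k_on 4 f W" "\<And>w. w \<in> W \<Longrightarrow> f w > 0"
    and h: "\<And>w. w \<in> W \<Longrightarrow> hermitian_form (h (F w))"
    and C: "C \<noteq> 0"
    and pot: "\<And>w u v. w \<in> W \<Longrightarrow> inverse (f w) * Re (\<i> * (\<Sum>i\<in>UNIV. \<Sum>j\<in>UNIV.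
         dz i (dzbar j (\<lambda>x. complex_of_real (f x))) w * (u $ i * cnj (v $ j) - v $ i * cnj (u $ j))))
       = C * h (F w) (cx_J (frechet_derivative F (at w) u)) (frechet_derivative F (at w) v)"
    and z: "z \<in> F ` W"
  shows "Q_tensor (metric_comp h) i j k l z = Q_tensor (metric_comp h) k l i j z"
proof -
  define V where "V = F ` W"
  define E where "E = the_inv_into W F"
  define \<Phi> where "\<Phi> x = complex_of_real (f x)" for x
  define \<Psi> where "\<Psi> x = \<Phi> (E x)" for x
  have "\<forall>w\<in>W. inj (frechet_derivative F (at w))"
    using ker linear_injective_0[OF has_derivative_linear[OF hol_map_onD(1)[OF F(1)]]] by blast
  note inv = hol_map_on_inverse[OF W F this, folded V_def E_def]
  have EV: "E x \<in> W" "F (E x) = x" if "x \<in> V" for x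
    using that F(2) unfolding V_def E_def by (auto simp: the_inv_into_f_f)
  have \<Phi>: "C_k_on 4 \<Phi> W"
    unfolding \<Phi>_def[abs_def] by (rule C_k_on_bounded_linear[OF bounded_linear_of_real W f(1)])
  have \<Psi>: "C_k_on 4 \<Psi> V"
    unfolding \<Psi>_def[abs_def]
    by (rule C_k_on_compose[OF inv(1) _ \<Phi> hol_map_on_C_k_on[OF inv(2,1)]]) (use EV in auto)
  have real: "cnj (\<Psi> x) = \<Psi> x" for x by (simp add: \<Psi>_def \<Phi>_def)
  have nz: "\<Psi> x \<noteq> 0" if "x \<in> V" for x using f(2)[OF EV(1)[OF that]] by (simp add: \<Psi>_def \<Phi>_def)
  have hx: "hermitian_form (h x)" if "x \<in> V" for x using h[OF EV(1)[OF that]] EV(2)[OF that] by simp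
  have herm: "dz l (dzbar k \<Psi>) x = cnj (dz k (dzbar l \<Psi>) x)" if "x \<in> V" for k l x
    by (rule cnj_dz_dzbar_real[OF inv(1) that C_k_on_mono[OF \<Psi>] real, symmetric]) simp_all
  have potential: "dz k (dzbar l \<Psi>) x = of_real C * \<Psi> x * metric_comp h x $ k $ l" if x: "x \<in> V" for x k l
  proof -
    interpret hf: hermitian_form "h x" by (rule hx[OF x])
    let ?w = "E x"
    let ?e = "\<lambda>i. frechet_derivative E (at x) (axis i 1)"
    have DE: "frechet_derivative F (at ?w) (frechet_derivative E (at x) v) = v" for v
      using inv(3)[OF EV(1)[OF x], of v] EV(2)[OF x] by simp
    have P: "dz k (dzbar l \<Psi>) x = (\<Sum>a\<in>UNIV. \<Sum>b\<in>UNIV. dz a (dzbar b \<Phi>) ?w * (?e k $ a * cnj (?e l $ b)))" for k l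
      unfolding \<Psi>_def[abs_def]
      by (rule dz_dzbar_compose_hol[OF inv(1) W inv(2) _ C_k_on_mono[OF \<Phi>] x]) (use EV in auto)
    have pot': "inverse (f ?w) * Re (\<i> * (\<Sum>a\<in>UNIV. \<Sum>b\<in>UNIV. dz a (dzbar b \<Phi>) ?w *
        (frechet_derivative E (at x) u $ a * cnj (frechet_derivative E (at x) v $ b)
         - frechet_derivative E (at x) v $ a * cnj (frechet_derivative E (at x) u $ b))))
       = C * h x (cx_J u) v" for u v
      using pot[OF EV(1)[OF x], of "frechet_derivative E (at x) u" "frechet_derivative E (at x) v"]
      unfolding DE EV(2)[OF x] \<Phi>_def[abs_def] .
    have fw: "f ?w > 0" by (rule f(2)[OF EV(1)[OF x]])
    have eJ: "frechet_derivative E (at x) (cx_J v) = cx_J (frechet_derivative E (at x) v)" for v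
      by (rule hol_map_onD(2)[OF inv(2) x])
    \<comment> \<open>On \<open>axis k 1\<close> and \<open>axis l 1\<close> the form sees the
      difference of a Hessian entry and its conjugate, hence the imaginary part.\<close>
    have "inverse (f ?w) * Re (\<i> * (dz k (dzbar l \<Psi>) x - dz l (dzbar k \<Psi>) x)) = C * h x (cx_J (axis k 1)) (axis l 1)"
      using pot'[of "axis k 1" "axis l 1"]
      by (simp only: P right_diff_distrib sum_subtractf)
    then have im: "2 * Im (dz k (dzbar l \<Psi>) x) = C * f ?w * h x (axis k 1) (cx_J (axis l 1))"
      using fw unfolding herm[OF x, of l k] hf.J_left by (simp add: field_simps)
    \<comment> \<open>Replacing the second vector by its image under J changes the difference into a
      sum, which yields the real part.\<close>
    have "(\<Sum>a\<in>UNIV. \<Sum>b\<in>UNIV. dz a (dzbar b \<Phi>) ?w *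
        (?e k $ a * cnj (cx_J (?e l) $ b) - cx_J (?e l) $ a * cnj (?e k $ b)))
      = - \<i> * (dz k (dzbar l \<Psi>) x + dz l (dzbar k \<Psi>) x)"
      unfolding P by (simp add: sum_distrib_left sum.distrib sum_subtractf sum_negf algebra_simps)
    then have "inverse (f ?w) * Re (dz k (dzbar l \<Psi>) x + dz l (dzbar k \<Psi>) x) = C * h x (cx_J (axis k 1)) (cx_J (axis l 1))"
      using pot'[of "axis k 1" "cx_J (axis l 1)"] unfolding eJ by (simp add: add.commute)
    then have re: "2 * Re (dz k (dzbar l \<Psi>) x) = C * f ?w * h x (axis k 1) (axis l 1)"
      using fw unfolding herm[OF x, of l k] hf.J_invariant by (simp add: field_simps)
    show ?thesis
      using im re unfolding metric_comp_hermitian[of h x, OF hx[OF x]]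
      by (simp add: complex_eq_iff hf.sesq_def \<Psi>_def \<Phi>_def)
  qed
  interpret local_lck_potential V \<Psi> "metric_comp h" "of_real C"
  proof
    show "invertible (metric_comp h x)" if "x \<in> V" for x
      unfolding metric_comp_hermitian[of h x, OF hx[OF that]] by (rule hermitian_form.invertible_gram[OF hx[OF that]])
  qed (use inv(1) \<Psi> real nz C potential in auto)
  show ?thesis using z by (intro Q_tensor_symmetric) (simp add: V_def)
qed

theorem proposition4p2:
  fixes A :: "('m::{t2_space,second_countable_topology}, 'n::finite) chart set"
    and g :: "('m, 'n) two_tensor"
  assumes "lck_with_potential TYPE('t::{t2_space,second_countable_topology}) A g"
  shows "\<forall>c\<in>A. \<forall>z\<in>chart_img c. \<forall>i j k l.
    Q_tensor (metric_comp (g c)) i j k l z = Q_tensor (metric_comp (g c)) k l i j z"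
proof (intro ballI allI)
  fix d z i j k l
  assume d: "d \<in> A" and z: "z \<in> chart_img d"
  from assms obtain B :: "('t, 'n) chart set" and p \<phi> C where
    B: "complex_manifold B" and cov: "holomorphic_covering B A p"
    and \<phi>: "smooth_fun B \<phi>" "\<And>x. \<phi> x > 0" and kahler: "kahler_form B (i_ddbar \<phi>)"
    and pot: "\<And>c d z u v. c \<in> B \<Longrightarrow> d \<in> A \<Longrightarrow> z \<in> loc_dom p c d \<Longrightarrow>
         inverse (\<phi> (chart_inv c z)) * i_ddbar \<phi> c z u v
             = C * assoc_form g d (loc_map p c d z)
                 (frechet_derivative (loc_map p c d) (at z) u)
                 (frechet_derivative (loc_map p c d) (at z) v)"
    unfolding lck_with_potential_def by blast
  have A: "complex_manifold A" and g: "hermitian_metric A g"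
    using assms unfolding lck_with_potential_def lck_manifold_def by blast+
  have cs: "covering_space UNIV p UNIV"
    and hol: "\<And>c d. c \<in> B \<Longrightarrow> d \<in> A \<Longrightarrow> hol_map_on (loc_map p c d) (loc_dom p c d)"
    using cov unfolding holomorphic_covering_def by blast+
  have chd: "is_chart d" using A d unfolding complex_manifold_def by blast
  obtain t where t: "p t = chart_inv d z"
    using covering_space_imp_surjective[OF cs] by (metis UNIV_I imageE)
  obtain c where c: "c \<in> B" "t \<in> fst c" using B unfolding complex_manifold_def by blast
  have chc: "is_chart c" using B c unfolding complex_manifold_def by blast
  \<comment> \<open>The covering property supplies an open \<open>T\<close> around \<open>t\<close>
    on which \<open>p\<close> is injective; injectivity of the derivative comes from the pulled back
    form instead.\<close>
  obtain T u q where T: "t \<in> T" "openin (top_of_set UNIV) T" "homeomorphism T u p q"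
    using covering_space_local_homeomorphism[OF cs UNIV_I] by metis
  \<comment> \<open>Inside the chart \<open>c\<close>, the set \<open>T\<close> makes the coordinate
    expression injective and the preimage of \<open>fst d\<close> makes it meaningful.\<close>
  define W where "W = chart_img c \<inter> chart_inv c -` (T \<inter> p -` fst d)"
  let ?F = "loc_map p c d"
  have W_dom: "W \<subseteq> loc_dom p c d" unfolding W_def loc_dom_def by auto
  have W_img: "W \<subseteq> chart_img c" unfolding W_def by auto
  have "continuous_on UNIV p" using cs by (rule covering_space_imp_continuous)
  moreover have "open (fst d)" "open (chart_img c)" using chd chc unfolding is_chart_def by auto
  ultimately have W: "open W"
    unfolding W_def using T(2)
    by (intro continuous_open_preimage[OF chart_inv(5)[OF chc]] open_Int) (auto simp: open_vimage)
  have F: "hol_map_on ?F W" using hol[OF c(1) d] W_dom unfolding hol_map_on_def by blast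
  have inj: "inj_on ?F W"
  proof (rule inj_onI)
    fix x y assume xy: "x \<in> W" "y \<in> W" "?F x = ?F y"
    then have "p (chart_inv c x) = p (chart_inv c y)"
      using inj_onD[OF chart_inv(4)[OF chd]] unfolding W_def loc_map_def by auto
    then have "chart_inv c x = chart_inv c y"
      using xy T(3) unfolding W_def homeomorphism_def by (metis IntE vimageE)
    then show "x = y" using xy W_img chart_inv(2)[OF chc] by (metis subsetD)
  qed
  have F_img: "?F w \<in> chart_img d" if "w \<in> W" for w
    using that unfolding W_def loc_map_def chart_img_def by auto
  have herm: "hermitian_form (g d x)" if "x \<in> chart_img d" for x
    using g d that unfolding hermitian_metric_def two_tensor_field_def hermitian_form_def by blast
  have potW: "inverse (\<phi> (chart_inv c w)) * i_ddbar \<phi> c w u v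
     = C * assoc_form g d (?F w) (frechet_derivative ?F (at w) u) (frechet_derivative ?F (at w) v)"
    if "w \<in> W" for w u v
    using pot[OF c(1) d] W_dom that by blast
  have bil: "bilinear (g d (?F w))" if "w \<in> W" for w
    using hermitian_form.bil[OF herm[OF F_img[OF that]]] .
  note ker = frechet_derivative_loc_map_kernel[OF bil kahler c(1) subsetD[OF W_img] potW \<phi>(2)]
  have tW: "snd c t \<in> W"
    unfolding W_def using c(2) T(1) t chart_inv(1)[OF chd z] chart_inv(3)[OF chc c(2)]
    by (auto simp: chart_img_def)
  \<comment> \<open>The form has to be tested at an actual point, and the coordinates of
    \<open>t\<close> provide one.\<close>
  have C: "C \<noteq> 0" by (rule ker(1)) (rule tW)+
  have "?F (snd c t) = z"
    using t chart_inv(3)[OF chc c(2)] chart_inv(2)[OF chd z] by (simp add: loc_map_def)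
  with tW have zW: "z \<in> ?F ` W" by (metis imageI)
  have smooth: "C_k_on 4 (\<lambda>x. \<phi> (chart_inv c x)) W"
    using \<phi>(1) c(1) W_img unfolding smooth_fun_def smooth_on_def by (blast intro: C_k_on_subset)
  show "Q_tensor (metric_comp (g d)) i j k l z = Q_tensor (metric_comp (g d)) k l i j z"
    by (rule Q_tensor_symmetric_pullback[OF W F inj ker(2) smooth \<phi>(2) herm[OF F_img] C
          potW[unfolded i_ddbar_def assoc_form_def] zW])
qed

end
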